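(* Let $n \ge 3$ be an integer, let $a, b$ be real numbers with $a < \frac{n-2}{2}$ and $a \le b \le a+1$, set $p = \frac{2n}{n-2+2(b-a)}$, and let $u \in C_c^{\infty}(\mathbb{R}^n)$. Let $\theta \in [0,1]$ be determined by $p = 2(1-\theta) + \frac{2n}{n-2}\theta$. Then $$\left(\int_{\mathbb{R}^{n}}\frac{|u(x)|^{p}}{\|x\|^{bp}}\,dx\right)^{2/p} \leq C_{a^{\pm}}^{\alpha}\,C_{a+1}^{\beta}\int_{\mathbb{R}^{n}}\frac{\|\nabla u(x)\|^{2}}{\|x\|^{2a}}\,dx,$$ where $\alpha = \frac{2n\theta}{(n-2)p}$, $\beta = \frac{2(1-\theta)}{p}$, $C_{a+1} = \frac{4}{(n-2-2a)^2}$, and $C_{a^\pm} = K(n,2)^2\left(\frac{n-2}{n-2-2a}\right)^2$ if $a \ge 0$, while $C_{a^\pm} = K(n,2)^2\left(\frac{n-2-4a}{n-2-2a}\right)^2$ if $a \le 0$.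
   Context: $\|\cdot\|$ denotes the Euclidean norm on $\mathbb{R}^n$, $|\cdot|$ the absolute value on $\mathbb{R}$, and $dx$ Lebesgue measure. $K(n,2)$ denotes the sharp constant in the Sobolev inequality $\left(\int_{\mathbb{R}^n}|f|^{2^*}dx\right)^{1/2^*} \le K(n,2)\left(\int_{\mathbb{R}^n}\|\nabla f\|^2dx\right)^{1/2}$ for all $f \in W^{1,2}(\mathbb{R}^n)$, $2^* = 2n/(n-2)$. Since $2 \le p \le 2^*$, the parameter $\theta\in[0,1]$ is uniquely determined. *)

theory Defs
  imports "HOL-Analysis.Analysis"
begin

fun Ck :: "nat \<Rightarrow> (real^'n \<Rightarrow> real) \<Rightarrow> bool" where
  "Ck 0 f = continuous_on UNIV f"
| "Ck (Suc k) f = ((\<forall>x. f differentiable (at x)) \<and>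
      (\<forall>v. Ck k (\<lambda>x. frechet_derivative f (at x) v)))"

definition smooth_cc :: "(real^'n \<Rightarrow> real) \<Rightarrow> bool" where
  "smooth_cc f \<longleftrightarrow> (\<forall>k. Ck k f) \<and> compact (closure {x. f x \<noteq> 0})"

definition grad :: "(real^'n \<Rightarrow> real) \<Rightarrow> real^'n \<Rightarrow> real^'n" where
  "grad f x = (\<chi> i. frechet_derivative f (at x) (axis i 1))"

text \<open>Sharp Sobolev constant K(n,2), n = CARD('n), 2^* = 2n/(n-2):
  the least constant in the Sobolev inequality (tested on C_c^infinity, dense in W^{1,2}).\<close>
definition sobolev_K :: "'n::finite itself \<Rightarrow> real" where
  "sobolev_K _ = Inf {K. K \<ge> 0 \<and> (\<forall>f::real^'n \<Rightarrow> real. smooth_cc f \<longrightarrow>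
      (\<integral>x. \<bar>f x\<bar> powr (2 * CARD('n) / (CARD('n) - 2)) \<partial>lborel)
          powr ((CARD('n) - 2) / (2 * CARD('n)))
      \<le> K * (\<integral>x. (norm (grad f x))\<^sup>2 \<partial>lborel) powr (1/2))}"

end

theory Submission
  imports Defs
begin

text \<open>
  Hoelder's inequality interpolates the claim between its two endpoints \<open>b = a + 1\<close> and
  \<open>b = a\<close>. The first is the weighted Hardy inequality, which follows from the divergence
  theorem for the field \<open>u\<^sup>2 x / norm x powr (2 * a + 2)\<close>. For the second, the Sobolev inequality is
  applied to \<open>v = u / norm x powr a\<close>; integrating the cross term by parts gives
  \<open>\<integral> \<bar>\<nabla>v\<bar>\<^sup>2 = A + a (n - 2 - a) H\<close>, where \<open>A\<close> is the weighted Dirichlet energy of \<open>u\<close> and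
  \<open>H\<close> its Hardy integral, and Hardy's inequality bounds this by the constant claimed.
  Singular weights are handled as limits of powers of \<open>\<delta> + norm x ^ 2\<close>.

  The sharp constant is an infimum, so one also needs that the Sobolev inequality holds with some
  constant at all. This is derived from a Faber--Krahn inequality by truncation at dyadic levels;
  Faber--Krahn in turn follows from
  \<open>\<integral> (f (x + h) - f x)\<^sup>2 \<le> (norm h)\<^sup>2 * \<integral> \<bar>\<nabla>f\<bar>\<^sup>2\<close> by averaging over \<open>h\<close> in a ball.
\<close>

section \<open>Compactly supported functions of class \<open>C\<^sup>1\<close>\<close>

text \<open>A real infimum over an empty set is unspecified, so \<open>sobolev_K\<close> carries no
  information until one finite constant is known; hence the full proof of a Sobolev inequality.
  Faber--Krahn controls the L^2 mass of a function by the size of its support, and truncation turns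
  this into a relation between consecutive level sets of f^2. The truncations are no longer smooth,
  which is why the larger class \<open>C1_cc\<close> is used: a continuous gradient and compact
  support suffice to dominate all difference quotients. Both halves of this argument end by
  absorption. Averaging over a ball of twice the volume leaves half of the L^2 mass on the left; the
  sum over levels is bounded by its own power with exponent 2/n < 1, by which one can divide because
  the sum is finite.

  The weight \<open>norm x powr (- a)\<close> is in general not smooth at the origin, while
  \<open>sobolev_K\<close> speaks of \<open>smooth_cc\<close> functions only, so the regularised
  weights must enter before any inequality is applied. The constant for a >= 0 rests on the identity
  (n - 2 - 2a)^2 + 4a(n - 2 - a) = (n - 2)^2.\<close>

definition C1_cc :: "(real^'n \<Rightarrow> real) \<Rightarrow> bool" where
  "C1_cc f \<longleftrightarrow> Ck (Suc 0) f \<and> compact (closure {x. f x \<noteq> 0})"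

lemma has_derivative_grad:
  fixes f :: "real^'n \<Rightarrow> real"
  assumes "f differentiable (at x)"
  shows "(f has_derivative (\<lambda>v. grad f x \<bullet> v)) (at x)"
proof -
  let ?D = "frechet_derivative f (at x)"
  have D: "(f has_derivative ?D) (at x)"
    using assms frechet_derivative_works by blast
  then interpret bounded_linear ?D by (rule has_derivative_bounded_linear)
  have "?D v = grad f x \<bullet> v" for v
  proof -
    have "?D v = ?D (\<Sum>i\<in>UNIV. v $ i *\<^sub>R axis i 1)"
      using basis_expansion[of v] by (simp add: scalar_mult_eq_scaleR)
    also have "\<dots> = grad f x \<bullet> v"
      by (simp add: sum scaleR grad_def inner_vec_def mult.commute)
    finally show ?thesis .
  qed
  then show ?thesis using D by presburger
qed

lemma grad_unique:
  fixes f :: "real^'n \<Rightarrow> real"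
  assumes "(f has_derivative (\<lambda>v. g \<bullet> v)) (at x)"
  shows "grad f x = g"
proof -
  have "frechet_derivative f (at x) = (\<lambda>v. g \<bullet> v)"
    using frechet_derivative_at[OF assms] by simp
  then show ?thesis by (simp add: grad_def vec_eq_iff inner_axis)
qed

lemma has_derivative_imp_differentiable: "(f has_derivative f') F \<Longrightarrow> f differentiable F"
  by (auto simp: differentiable_def)

lemma C1_ccI:
  fixes f :: "real^'n \<Rightarrow> real"
  assumes d: "\<And>x. (f has_derivative (\<lambda>v. g x \<bullet> v)) (at x)"
    and g: "continuous_on UNIV g" and s: "bounded S" "\<And>x. x \<notin> S \<Longrightarrow> f x = 0"
  shows "C1_cc f"
proof -
  have "frechet_derivative f (at x) v = g x \<bullet> v" for x v
    using frechet_derivative_at[OF d] by simp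
  moreover have "bounded {x. f x \<noteq> 0}"
    using s bounded_subset[of S "{x. f x \<noteq> 0}"] by blast
  ultimately show ?thesis
    unfolding C1_cc_def using g
    by (auto simp: compact_closure intro!: has_derivative_imp_differentiable[OF d] continuous_intros)
qed

lemma smooth_cc_imp_C1_cc: "smooth_cc f \<Longrightarrow> C1_cc f"
  by (auto simp: smooth_cc_def C1_cc_def simp del: Ck.simps)

context
  fixes f :: "real^'n \<Rightarrow> real"
  assumes f: "C1_cc f"
begin

lemma C1_cc_has_derivative: "(f has_derivative (\<lambda>v. grad f x \<bullet> v)) (at x)"
  using f by (intro has_derivative_grad) (auto simp: C1_cc_def)

lemma C1_cc_continuous: "continuous_on S f"
  using C1_cc_has_derivative has_derivative_continuous continuous_at_imp_continuous_on by blast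

lemma C1_cc_grad_continuous: "continuous_on S (grad f)"
proof -
  have "continuous_on UNIV (grad f)"
    using f unfolding C1_cc_def grad_def by (intro continuous_intros) auto
  then show ?thesis using continuous_on_subset by blast
qed

lemma C1_cc_support: "\<exists>R>0. \<forall>x. norm x > R \<longrightarrow> f x = 0 \<and> grad f x = 0"
proof -
  have "bounded (closure {x. f x \<noteq> 0})"
    using f by (auto simp: C1_cc_def compact_imp_bounded)
  then obtain R where R: "R > 0" "\<And>x. x \<in> closure {x. f x \<noteq> 0} \<Longrightarrow> norm x \<le> R"
    by (auto simp: bounded_pos)
  have *: "f x = 0" if "norm x > R" for x
    using R(2)[of x] that closure_subset[of "{x. f x \<noteq> 0}"] by force
  have "grad f x = 0" if "norm x > R" for x
  proof (rule grad_unique)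
    have "open {y::real^'n. norm y > R}"
      by (intro open_Collect_less continuous_intros)
    moreover have "((\<lambda>_. 0) has_derivative (\<lambda>v. 0 \<bullet> v)) (at x)" by simp
    ultimately show "(f has_derivative (\<lambda>v. 0 \<bullet> v)) (at x)"
      using that * has_derivative_transform_within_open[of "\<lambda>_. 0" "\<lambda>v. 0 \<bullet> v" x UNIV "{y. norm y > R}" f]
      by auto
  qed
  with * R(1) show ?thesis by blast
qed

lemma C1_cc_bound: "\<exists>M>0. \<forall>x. \<bar>f x\<bar> \<le> M \<and> norm (grad f x) \<le> M"
proof -
  obtain R where R: "R > 0" "\<And>x. norm x > R \<Longrightarrow> f x = 0 \<and> grad f x = 0"
    using C1_cc_support by blast
  have "compact (f ` cball 0 R)" "compact (grad f ` cball 0 R)"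
    by (intro compact_continuous_image C1_cc_continuous C1_cc_grad_continuous compact_cball)+
  then have "bounded (f ` cball 0 R)" "bounded (grad f ` cball 0 R)"
    by (auto simp: compact_imp_bounded)
  then obtain M N where M: "\<And>x. norm x \<le> R \<Longrightarrow> \<bar>f x\<bar> \<le> M" and N: "\<And>x. norm x \<le> R \<Longrightarrow> norm (grad f x) \<le> N"
    unfolding bounded_iff by force
  have "\<bar>f x\<bar> \<le> max 1 (max M N) \<and> norm (grad f x) \<le> max 1 (max M N)" for x
    using M[of x] N[of x] R(2)[of x] by (cases "norm x \<le> R") auto
  then show ?thesis by (intro exI[of _ "max 1 (max M N)"]) auto
qed

lemma C1_cc_Lipschitz:
  assumes "\<And>x. norm (grad f x) \<le> M"
  shows "\<bar>f (x + v) - f x\<bar> \<le> M * norm v"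
proof -
  have "norm (f (x + v) - f x) \<le> M * norm ((x + v) - x)"
  proof (rule differentiable_bound[OF convex_UNIV])
    fix y
    show "(f has_derivative (\<lambda>v. grad f y \<bullet> v)) (at y within UNIV)"
      using C1_cc_has_derivative by simp
    show "onorm ((\<bullet>) (grad f y)) \<le> M"
      proof (rule onorm_le)
      fix w
      have "norm (grad f y \<bullet> w) \<le> norm (grad f y) * norm w"
        using Cauchy_Schwarz_ineq2[of "grad f y" w] by simp
      also have "\<dots> \<le> M * norm w" using assms by (intro mult_right_mono) auto
      finally show "norm (grad f y \<bullet> w) \<le> M * norm w" .
    qed
  qed auto
  then show ?thesis by simp
qed

text \<open>The step runs through the sequence 1/(N+1), the form in which dominated convergence is
  applied later.\<close>

lemma C1_cc_difference_quotient:
  "(\<lambda>N. real (Suc N) * (f (x + v /\<^sub>R real (Suc N)) - f x)) \<longlonglongrightarrow> grad f x \<bullet> v"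
proof -
  have "((\<lambda>t. f (x + t *\<^sub>R v)) has_derivative (\<lambda>t. grad f x \<bullet> (t *\<^sub>R v))) (at 0)"
    by (rule has_derivative_compose[where g=f, of "\<lambda>t. x + t *\<^sub>R v" "\<lambda>t. t *\<^sub>R v"])
       (auto intro!: derivative_eq_intros C1_cc_has_derivative)
  then have "((\<lambda>t. f (x + t *\<^sub>R v)) has_field_derivative (grad f x \<bullet> v)) (at 0)"
    by (simp add: has_field_derivative_def mult.commute[of _ "grad f x \<bullet> v"])
  then have "(\<lambda>t. (f (x + t *\<^sub>R v) - f x) / t) \<midarrow>0\<rightarrow> grad f x \<bullet> v"
    by (simp add: DERIV_def)
  moreover have "filterlim (\<lambda>N. inverse (real (Suc N))) (at 0) sequentially"
    using LIMSEQ_inverse_real_of_nat by (simp add: filterlim_at)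
  ultimately have "(\<lambda>N. (f (x + inverse (real (Suc N)) *\<^sub>R v) - f x) / inverse (real (Suc N)))
     \<longlonglongrightarrow> grad f x \<bullet> v"
    by (rule filterlim_compose)
  then show ?thesis by (simp add: divide_inverse mult.commute)
qed

end

section \<open>Integrability of compactly supported functions and translation invariance of Lebesgue
  measure\<close>

lemma integrable_bounded_support:
  fixes g :: "'a::euclidean_space \<Rightarrow> real"
  assumes [measurable]: "g \<in> borel_measurable borel"
    and "\<And>x. \<bar>g x\<bar> \<le> M" "\<And>x. norm x > R \<Longrightarrow> g x = 0"
  shows "integrable lborel g"
proof (rule Bochner_Integration.integrable_bound[where f="\<lambda>x. M * indicator (cball 0 R) x"])
  show "integrable lborel (\<lambda>x. M * indicator (cball 0 R) x :: real)"
    using emeasure_lborel_cball_finite[of 0 R] by (intro integrable_mult_right) auto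
  show "AE x in lborel. norm (g x) \<le> norm (M * indicator (cball 0 R) x :: real)"
  proof (intro AE_I2)
    fix x
    show "norm (g x) \<le> norm (M * indicator (cball 0 R) x :: real)"
      using assms(2)[of x] assms(3)[of x] by (auto simp: indicator_def)
  qed
qed auto

lemma integrable_continuous_support:
  fixes g :: "'a::euclidean_space \<Rightarrow> real"
  assumes "continuous_on UNIV g" "\<And>x. norm x > R \<Longrightarrow> g x = 0"
  shows "integrable lborel g"
proof -
  have "bounded (g ` cball 0 R)"
    using assms(1) by (intro compact_imp_bounded compact_continuous_image) (auto intro: continuous_on_subset)
  then obtain M where M: "\<And>x. norm x \<le> R \<Longrightarrow> \<bar>g x\<bar> \<le> M"
    unfolding bounded_iff by force
  have "\<bar>g x\<bar> \<le> max 0 M" for x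
    using M[of x] assms(2)[of x] by (cases "norm x \<le> R") auto
  then show ?thesis
    using assms by (intro integrable_bounded_support[where R=R]) (auto intro: borel_measurable_continuous_onI)
qed

lemma integral_lborel_translation:
  fixes g :: "'a::euclidean_space \<Rightarrow> real"
  assumes [measurable]: "g \<in> borel_measurable borel"
  shows "(\<integral>x. g (x + h) \<partial>lborel) = (\<integral>x. g x \<partial>lborel)"
proof -
  have "(\<integral>x. g x \<partial>lborel) = (\<integral>x. g x \<partial>(distr lborel borel ((+) h)))"
    by (simp add: lborel_distr_plus)
  also have "\<dots> = (\<integral>x. g (h + x) \<partial>lborel)"
    by (subst integral_distr) auto
  finally show ?thesis by (simp add: add.commute)
qed

lemma integrable_lborel_translation:
  fixes g :: "'a::euclidean_space \<Rightarrow> real"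
  assumes "integrable lborel g"
  shows "integrable lborel (\<lambda>x. g (x + h))"
proof -
  have "integrable (distr lborel borel ((+) h)) g"
    using assms by (simp add: lborel_distr_plus)
  then show ?thesis
    by (subst (asm) integrable_distr_eq) (use assms in \<open>auto simp: add.commute\<close>)
qed

lemma nn_integral_lborel_translation:
  fixes g :: "'a::euclidean_space \<Rightarrow> ennreal"
  assumes [measurable]: "g \<in> borel_measurable borel"
  shows "(\<integral>\<^sup>+x. g (x + h) \<partial>lborel) = (\<integral>\<^sup>+x. g x \<partial>lborel)"
proof -
  have "(\<integral>\<^sup>+x. g x \<partial>lborel) = (\<integral>\<^sup>+x. g x \<partial>(distr lborel borel ((+) h)))"
    by (simp add: lborel_distr_plus)
  also have "\<dots> = (\<integral>\<^sup>+x. g (h + x) \<partial>lborel)"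
    by (subst nn_integral_distr) auto
  finally show ?thesis by (simp add: add.commute)
qed

text \<open>The Lipschitz bound cancels the factor N+1, and since every step has length at most
  \<open>norm v\<close>, enlarging the support ball by \<open>norm v\<close> serves all N at once.
  This gives one integrable majorant for all difference quotients.\<close>

lemma C1_cc_difference_quotient_bound:
  fixes f :: "real^'n \<Rightarrow> real"
  assumes f: "C1_cc f"
  obtains B R where "\<And>N x. \<bar>real (Suc N) * (f (x + v /\<^sub>R real (Suc N)) - f x)\<bar> \<le> B * indicator (cball 0 R) x"
proof -
  obtain R where R: "R > 0" "\<And>x. norm x > R \<Longrightarrow> f x = 0 \<and> grad f x = 0"
    using C1_cc_support[OF f] by blast
  obtain M where M: "M > 0" "\<And>x. norm (grad f x) \<le> M"
    using C1_cc_bound[OF f] by blast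
  have "\<bar>real (Suc N) * (f (x + v /\<^sub>R real (Suc N)) - f x)\<bar>
      \<le> M * norm v * indicator (cball 0 (R + norm v)) x" for N x
  proof (cases "norm x \<le> R + norm v")
    case True
    have "\<bar>real (Suc N) * (f (x + v /\<^sub>R real (Suc N)) - f x)\<bar>
        \<le> real (Suc N) * (M * norm (v /\<^sub>R real (Suc N)))"
      unfolding abs_mult using C1_cc_Lipschitz[OF f M(2), of x "v /\<^sub>R real (Suc N)"]
      by (intro mult_mono) auto
    also have "\<dots> = M * norm v" by (simp add: field_simps)
    finally show ?thesis using True by simp
  next
    case False
    have "norm x \<le> norm (x + v /\<^sub>R real (Suc N)) + norm (v /\<^sub>R real (Suc N))"
      by (metis add_diff_cancel norm_triangle_ineq4)
    moreover have "norm (v /\<^sub>R real (Suc N)) \<le> norm v"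
      by (simp add: divide_le_eq field_simps)
    moreover have "norm x > R" using False R by (smt (verit) norm_ge_zero)
    ultimately have "norm (x + v /\<^sub>R real (Suc N)) > R" using False by linarith
    then show ?thesis using R(2) \<open>norm x > R\<close> False by simp
  qed
  then show ?thesis using that by blast
qed

lemma integrable_const_indicator_cball:
  "integrable lborel (\<lambda>x::'a::euclidean_space. B * indicator (cball 0 R) x :: real)"
  using emeasure_lborel_cball_finite[of 0 R] by (intro integrable_mult_right) auto

text \<open>By translation invariance the integral of every difference quotient vanishes.\<close>

lemma integral_directional_derivative_eq_0:
  fixes f :: "real^'n \<Rightarrow> real"
  assumes f: "C1_cc f"
  shows "(\<integral>x. grad f x \<bullet> v \<partial>lborel) = 0"
proof -
  obtain R where R: "R > 0" "\<And>x. norm x > R \<Longrightarrow> f x = 0 \<and> grad f x = 0"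
    using C1_cc_support[OF f] by blast
  have [measurable]: "f \<in> borel_measurable borel" "grad f \<in> borel_measurable borel"
    by (auto intro!: borel_measurable_continuous_onI C1_cc_continuous C1_cc_grad_continuous f)
  have intf: "integrable lborel f"
    using R C1_cc_continuous[OF f] by (intro integrable_continuous_support) auto
  define s where "s N x = real (Suc N) * (f (x + v /\<^sub>R real (Suc N)) - f x)" for N x
  obtain B R' where B: "\<And>N x. \<bar>s N x\<bar> \<le> B * indicator (cball 0 R') x"
    unfolding s_def using C1_cc_difference_quotient_bound[OF f, of v] by blast
  have "(\<lambda>N. \<integral>x. s N x \<partial>lborel) \<longlonglongrightarrow> (\<integral>x. grad f x \<bullet> v \<partial>lborel)"
  proof (rule integral_dominated_convergence[OF _ _ integrable_const_indicator_cball])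
    show "AE x in lborel. (\<lambda>N. s N x) \<longlonglongrightarrow> grad f x \<bullet> v"
      unfolding s_def using C1_cc_difference_quotient[OF f] by simp
    show "AE x in lborel. norm (s N x) \<le> B * indicator (cball 0 R') x" for N
      using B by simp
  qed (auto simp: s_def)
  moreover have "(\<integral>x. s N x \<partial>lborel) = 0" for N
    unfolding s_def using intf integrable_lborel_translation[OF intf] integral_lborel_translation[of f]
    by simp
  ultimately show ?thesis by (simp add: LIMSEQ_const_iff)
qed

section \<open>The Faber--Krahn inequality\<close>

lemma C1_cc_borel [measurable (raw)]:
  assumes "C1_cc f" shows "f \<in> borel_measurable borel" "grad f \<in> borel_measurable borel"
  by (auto intro!: borel_measurable_continuous_onI C1_cc_continuous C1_cc_grad_continuous assms)

lemma integrable_power2_C1_cc: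
  fixes f :: "real^'n \<Rightarrow> real"
  assumes "C1_cc f"
  shows "integrable lborel f" "integrable lborel (\<lambda>x. (f x)\<^sup>2)"
    "integrable lborel (\<lambda>x. (norm (grad f x))\<^sup>2)"
proof -
  obtain R where "R > 0" "\<And>x. norm x > R \<Longrightarrow> f x = 0 \<and> grad f x = 0"
    using C1_cc_support[OF assms] by blast
  then show "integrable lborel f" "integrable lborel (\<lambda>x. (f x)\<^sup>2)"
    "integrable lborel (\<lambda>x. (norm (grad f x))\<^sup>2)"
    using C1_cc_continuous[OF assms, of UNIV] C1_cc_grad_continuous[OF assms, of UNIV]
    by (auto intro!: integrable_continuous_support[where R=R] continuous_intros)
qed

lemma integrable_mult_of_power2:
  fixes f g :: "'a \<Rightarrow> real"
  assumes [measurable]: "f \<in> borel_measurable M" "g \<in> borel_measurable M"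
    and "integrable M (\<lambda>x. (f x)\<^sup>2)" "integrable M (\<lambda>x. (g x)\<^sup>2)"
  shows "integrable M (\<lambda>x. f x * g x)"
proof (rule Bochner_Integration.integrable_bound[where f="\<lambda>x. (f x)\<^sup>2 + (g x)\<^sup>2"])
  have "norm (a * b) \<le> norm (a\<^sup>2 + b\<^sup>2)" for a b :: real
  proof -
    have "\<bar>a\<bar> * \<bar>b\<bar> \<ge> 0" "2 * (\<bar>a\<bar> * \<bar>b\<bar>) \<le> a\<^sup>2 + b\<^sup>2"
      using sum_squares_bound[of "\<bar>a\<bar>" "\<bar>b\<bar>"] by (simp_all add: mult.assoc)
    then show ?thesis unfolding real_norm_def abs_mult by linarith
  qed
  then show "AE x in M. norm (f x * g x) \<le> norm ((f x)\<^sup>2 + (g x)\<^sup>2)" by simp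
qed (use assms in auto)

text \<open>Splitting the translation by \<open>h\<close> into \<open>N\<close> translations by \<open>h / N\<close> and letting
  \<open>N \<rightarrow> \<infinity>\<close> avoids both the fundamental theorem of calculus and Fubini's theorem.\<close>

lemma integral_power2_translation_le:
  fixes f :: "real^'n \<Rightarrow> real"
  assumes f: "C1_cc f"
  shows "(\<integral>x. (f (x + h) - f x)\<^sup>2 \<partial>lborel) \<le> (norm h)\<^sup>2 * (\<integral>x. (norm (grad f x))\<^sup>2 \<partial>lborel)"
proof -
  note [measurable] = C1_cc_borel[OF f]
  note int = integrable_power2_C1_cc[OF f]
  define s where "s = (\<lambda>N x. real (Suc N) * (f (x + h /\<^sub>R real (Suc N)) - f x))"
  obtain B R where B: "\<And>N x. \<bar>s N x\<bar> \<le> B * indicator (cball 0 R) x"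
    unfolding s_def using C1_cc_difference_quotient_bound[OF f, of h] by blast
  have s_meas [measurable]: "s N \<in> borel_measurable borel" for N
    by (simp add: s_def)
  have B2: "(s N x)\<^sup>2 \<le> B\<^sup>2 * indicator (cball 0 R) x" for N x
    using power_mono[OF B[of N x], of 2] by (auto simp: indicator_def power2_abs split: if_splits)
  have sint: "integrable lborel (\<lambda>x. (s N x)\<^sup>2)" for N
    by (rule Bochner_Integration.integrable_bound[OF integrable_const_indicator_cball[of "B\<^sup>2" R]])
       (use B2[of N] in \<open>auto intro!: AE_I2 order_trans[OF _ abs_ge_self]\<close>)
  \<comment> \<open>The increment is the mean of the N+1 translates \<open>d j\<close> of
    \<open>s N\<close>. The square of a mean is at most the mean of the squares, and all translates
    have the same integral, so no power of N is lost.\<close>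
  have split: "(\<integral>x. (f (x + h) - f x)\<^sup>2 \<partial>lborel) \<le> (\<integral>x. (s N x)\<^sup>2 \<partial>lborel)" for N
  proof -
    define K where "K = real (Suc N)"
    have K: "K > 0" by (simp add: K_def)
    define d where "d j x = s N (x + (real j / K) *\<^sub>R h)" for j x
    have dint: "integrable lborel (\<lambda>x. (d j x)\<^sup>2)" for j
      unfolding d_def by (rule integrable_lborel_translation[OF sint])
    have tele: "f (x + h) - f x = (\<Sum>j<Suc N. d j x) / K" for x
    proof -
      have "d j x / K = f (x + (real (Suc j) / K) *\<^sub>R h) - f (x + (real j / K) *\<^sub>R h)" for j
      proof -
        have "x + (real (Suc j) / K) *\<^sub>R h = x + (real j / K) *\<^sub>R h + h /\<^sub>R K"
          by (simp add: add_divide_distrib algebra_simps divide_inverse)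
        then show ?thesis using K by (simp add: d_def s_def K_def[symmetric] add.assoc del: of_nat_Suc)
      qed
      then have "(\<Sum>j<Suc N. d j x / K) = f (x + (real (Suc N) / K) *\<^sub>R h) - f (x + (real 0 / K) *\<^sub>R h)"
        using sum_lessThan_telescope[of "\<lambda>j. f (x + (real j / K) *\<^sub>R h)" "Suc N"] by (simp only:)
      then show ?thesis using K by (simp add: sum_divide_distrib[symmetric] K_def)
    qed
    have "(f (x + h) - f x)\<^sup>2 \<le> (\<Sum>j<Suc N. (d j x)\<^sup>2) / K" for x
    proof -
      have "(\<Sum>j<Suc N. d j x)\<^sup>2 \<le> (\<Sum>j<Suc N. (d j x)\<^sup>2) * K"
        using sum_squared_le_sum_of_squares[of "\<lambda>j. d j x" "{..<Suc N}"] by (simp add: K_def)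
      then have "(\<Sum>j<Suc N. d j x)\<^sup>2 / K\<^sup>2 \<le> (\<Sum>j<Suc N. (d j x)\<^sup>2) * K / K\<^sup>2"
        by (rule divide_right_mono) simp
      then show ?thesis
        unfolding tele power_divide using K by (simp add: power2_eq_square[of K] del: sum.lessThan_Suc)
    qed
    then have "(\<integral>x. (f (x + h) - f x)\<^sup>2 \<partial>lborel) \<le> (\<integral>x. (\<Sum>j<Suc N. (d j x)\<^sup>2) / K \<partial>lborel)"
      using dint K by (intro integral_mono') (auto simp del: sum.lessThan_Suc intro!: divide_nonneg_pos sum_nonneg)
    also have "\<dots> = (\<Sum>j<Suc N. \<integral>x. (d j x)\<^sup>2 \<partial>lborel) / K"
      using dint by (subst integral_divide_zero, subst Bochner_Integration.integral_sum) auto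
    also have "(\<Sum>j<Suc N. \<integral>x. (d j x)\<^sup>2 \<partial>lborel) = (\<Sum>j<Suc N. \<integral>x. (s N x)\<^sup>2 \<partial>lborel)"
      unfolding d_def using integral_lborel_translation[of "\<lambda>x. (s N x)\<^sup>2"] by simp
    finally show ?thesis using K by (simp add: K_def del: of_nat_Suc)
  qed
  have "(\<lambda>N. \<integral>x. (s N x)\<^sup>2 \<partial>lborel) \<longlonglongrightarrow> (\<integral>x. (grad f x \<bullet> h)\<^sup>2 \<partial>lborel)"
  proof (rule integral_dominated_convergence[OF _ _ integrable_const_indicator_cball[of "B\<^sup>2" R]])
    show "AE x in lborel. (\<lambda>N. (s N x)\<^sup>2) \<longlonglongrightarrow> (grad f x \<bullet> h)\<^sup>2"
      unfolding s_def using C1_cc_difference_quotient[OF f] by (auto intro!: tendsto_intros)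
    show "AE x in lborel. norm ((s N x)\<^sup>2) \<le> B\<^sup>2 * indicator (cball 0 R) x" for N
      using B2 by simp
  qed auto
  then have "(\<integral>x. (f (x + h) - f x)\<^sup>2 \<partial>lborel) \<le> (\<integral>x. (grad f x \<bullet> h)\<^sup>2 \<partial>lborel)"
    by (rule LIMSEQ_le_const) (use split in blast)
  also have "\<dots> \<le> (\<integral>x. (norm h)\<^sup>2 * (norm (grad f x))\<^sup>2 \<partial>lborel)"
  proof (rule integral_mono')
    show "(grad f x \<bullet> h)\<^sup>2 \<le> (norm h)\<^sup>2 * (norm (grad f x))\<^sup>2" for x
      using power_mono[OF Cauchy_Schwarz_ineq2[of "grad f x" h], of 2]
      by (simp add: power_mult_distrib power2_abs mult.commute)
  qed (use int in auto)
  finally show ?thesis by simp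
qed

text \<open>Cauchy--Schwarz for \<bar>f\<bar> against the indicator of \<open>E\<close>: the
  integral of the square of their combination is a quadratic in \<open>t\<close> that is never
  negative, evaluated at its minimiser L / e.\<close>

lemma integral_abs_power2_le_measure:
  fixes f :: "'a \<Rightarrow> real"
  assumes f: "integrable M f" "integrable M (\<lambda>x. (f x)\<^sup>2)"
    and E: "E \<in> sets M" "emeasure M E < \<infinity>" "\<And>x. x \<notin> E \<Longrightarrow> f x = 0"
  shows "(\<integral>x. \<bar>f x\<bar> \<partial>M)\<^sup>2 \<le> measure M E * (\<integral>x. (f x)\<^sup>2 \<partial>M)"
proof -
  define e L F where "e = measure M E" and "L = (\<integral>x. \<bar>f x\<bar> \<partial>M)" and "F = (\<integral>x. (f x)\<^sup>2 \<partial>M)"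
  have quad: "0 \<le> F - 2 * t * L + t\<^sup>2 * e" for t
  proof -
    have eq: "(\<bar>f x\<bar> - t * indicator E x)\<^sup>2 = (f x)\<^sup>2 - 2 * t * \<bar>f x\<bar> + t\<^sup>2 * indicator E x" for x
      using E(3)[of x] by (auto simp: indicator_def power2_eq_square algebra_simps)
    have "0 \<le> (\<integral>x. (\<bar>f x\<bar> - t * indicator E x)\<^sup>2 \<partial>M)" by simp
    also have "\<dots> = F - 2 * t * L + t\<^sup>2 * e"
      unfolding eq F_def L_def e_def using f E(1,2)
      by (subst Bochner_Integration.integral_add Bochner_Integration.integral_diff;
          (intro Bochner_Integration.integrable_diff integrable_mult_right)?; simp?)+
    finally show ?thesis .
  qed
  show ?thesis
  proof (cases "e = 0")
    case True
    have "L = 0"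
    proof (rule ccontr)
      assume "L \<noteq> 0"
      \<comment> \<open>With e = 0 the quadratic is F - 2 t L, and this \<open>t\<close> gives it
        the value -1.\<close>
      then show False using quad[of "(F + 1) / (2 * L)"] True by simp
    qed
    then show ?thesis using True by (simp add: e_def L_def)
  next
    case False
    then have "e > 0" by (simp add: e_def zero_less_measure_iff measure_nonneg order.not_eq_order_implies_strict)
    have "0 \<le> F - 2 * (L / e) * L + (L / e)\<^sup>2 * e" by (rule quad)
    also have "\<dots> = F - L\<^sup>2 / e" using \<open>e > 0\<close> by (simp add: power2_eq_square field_simps)
    finally show ?thesis using \<open>e > 0\<close> unfolding F_def L_def e_def by (simp add: field_simps)
  qed
qed

text \<open>Averaging the translation estimate over a ball whose volume is twice that of the support.\<close>

lemma Faber_Krahn: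
  fixes f :: "real^'n \<Rightarrow> real"
  assumes f: "C1_cc f"
    and E: "E \<in> sets borel" "emeasure lborel E < \<infinity>" "\<And>x. x \<notin> E \<Longrightarrow> f x = 0"
  shows "(\<integral>x. (f x)\<^sup>2 \<partial>lborel)
    \<le> (2 * measure lborel E / unit_ball_vol (real CARD('n))) powr (2 / real CARD('n))
      * (\<integral>x. (norm (grad f x))\<^sup>2 \<partial>lborel)"
proof -
  note [measurable] = C1_cc_borel[OF f]
  note int = integrable_power2_C1_cc[OF f]
  define n where "n = real CARD('n)"
  define e L F G where "e = measure lborel E" and "L = (\<integral>x. \<bar>f x\<bar> \<partial>lborel)"
    and "F = (\<integral>x. (f x)\<^sup>2 \<partial>lborel)" and "G = (\<integral>x. (norm (grad f x))\<^sup>2 \<partial>lborel)"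
  have n: "n > 0" by (simp add: n_def)
  have L: "L \<ge> 0" and FG: "F \<ge> 0" "G \<ge> 0" by (simp_all add: L_def F_def G_def)
  have LF: "L\<^sup>2 \<le> e * F"
    unfolding L_def e_def F_def using E int by (intro integral_abs_power2_le_measure) auto
  show ?thesis
  proof (cases "e = 0")
    case True
    then have "E \<in> null_sets lborel"
      using E(1,2) by (auto simp: e_def null_sets_def measure_def enn2real_eq_0_iff)
    then have "AE x in lborel. (f x)\<^sup>2 = 0"
      by (rule AE_I') (use E(3) in auto)
    then have "F = 0" unfolding F_def by (intro integral_eq_zero_AE)
    then show ?thesis unfolding F_def by simp
  next
    case False
    then have e: "e > 0" by (simp add: e_def order.not_eq_order_implies_strict)
    define w r where "w = unit_ball_vol n" and "r = (2 * e / w) powr (1 / n)"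
    have w: "w > 0" using n by (simp add: w_def)
    have r: "r > 0" using e w by (simp add: r_def)
    have rn: "r ^ CARD('n) = 2 * e / w"
      using e w r n unfolding r_def by (subst powr_realpow[symmetric]) (auto simp: powr_powr n_def)
    have vol: "emeasure lborel (ball (0::real^'n) r) = ennreal (2 * e)"
      using r rn w by (simp add: emeasure_ball flip: w_def n_def)
    \<comment> \<open>Expanding the square in the translation estimate: the two square terms
      contribute 2 F, so a short translation forces a large overlap of \<bar>f\<bar> with its
      translate.\<close>
    have psi: "F - r\<^sup>2 * G / 2 \<le> (\<integral>x. \<bar>f x\<bar> * \<bar>f (x + h)\<bar> \<partial>lborel)"
      and psi_int: "integrable lborel (\<lambda>x. \<bar>f x\<bar> * \<bar>f (x + h)\<bar>)" if "h \<in> ball 0 r" for h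
    proof -
      have int2: "integrable lborel (\<lambda>x. (f (x + h))\<^sup>2)"
        by (rule integrable_lborel_translation[OF int(2)])
      show int3: "integrable lborel (\<lambda>x. \<bar>f x\<bar> * \<bar>f (x + h)\<bar>)"
        using int int2 by (intro integrable_mult_of_power2) auto
      have int4: "integrable lborel (\<lambda>x. (f (x + h) - f x)\<^sup>2)"
      proof (rule Bochner_Integration.integrable_bound[where f="\<lambda>x. 2 * (f (x+h))\<^sup>2 + 2 * (f x)\<^sup>2"])
        have "(a - b)\<^sup>2 \<le> 2 * a\<^sup>2 + 2 * b\<^sup>2" for a b :: real
          using zero_le_power2[of "a + b"] by (simp add: power2_eq_square algebra_simps)
        then show "AE x in lborel. norm ((f (x + h) - f x)\<^sup>2) \<le> norm (2 * (f (x+h))\<^sup>2 + 2 * (f x)\<^sup>2)"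
          by simp
      qed (use int int2 in auto)
      have "2 * F = (\<integral>x. (f (x + h))\<^sup>2 + (f x)\<^sup>2 \<partial>lborel)"
        using int int2 integral_lborel_translation[of "\<lambda>x. (f x)\<^sup>2" h] by (simp add: F_def)
      also have "\<dots> \<le> (\<integral>x. (f (x + h) - f x)\<^sup>2 + 2 * (\<bar>f x\<bar> * \<bar>f (x + h)\<bar>) \<partial>lborel)"
      proof (rule integral_mono)
        have "a\<^sup>2 + b\<^sup>2 \<le> (a - b)\<^sup>2 + 2 * (\<bar>b\<bar> * \<bar>a\<bar>)" for a b :: real
          using abs_ge_self[of "a * b"] by (simp add: power2_eq_square algebra_simps abs_mult)
        then show "(f (x + h))\<^sup>2 + (f x)\<^sup>2 \<le> (f (x + h) - f x)\<^sup>2 + 2 * (\<bar>f x\<bar> * \<bar>f (x + h)\<bar>)" for x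
          by simp
      qed (use int int2 int3 int4 in auto)
      also have "\<dots> = (\<integral>x. (f (x + h) - f x)\<^sup>2 \<partial>lborel) + 2 * (\<integral>x. \<bar>f x\<bar> * \<bar>f (x + h)\<bar> \<partial>lborel)"
        using int3 int4 by simp
      also have "(\<integral>x. (f (x + h) - f x)\<^sup>2 \<partial>lborel) \<le> (norm h)\<^sup>2 * G"
        unfolding G_def by (rule integral_power2_translation_le[OF f])
      also have "(norm h)\<^sup>2 * G \<le> r\<^sup>2 * G"
        using that FG by (intro mult_right_mono power_mono) auto
      finally show "F - r\<^sup>2 * G / 2 \<le> (\<integral>x. \<bar>f x\<bar> * \<bar>f (x + h)\<bar> \<partial>lborel)" by simp
    qed
    have "2 * e * (F - r\<^sup>2 * G / 2) \<le> L\<^sup>2"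
    \<comment> \<open>The passage to \<open>ennreal\<close> truncates negative numbers to 0, so the
      lower bound is integrated over the ball only when it is non-negative. The double integral on
      the right splits into L * L by Fubini and translation invariance.\<close>
    proof (cases "F - r\<^sup>2 * G / 2 \<ge> 0")
      case False
      then have "2 * e * (F - r\<^sup>2 * G / 2) \<le> 0" using e by (simp add: mult_nonneg_nonpos)
      then show ?thesis by (smt (verit) zero_le_power2)
    next
      case True
      have "ennreal (2 * e * (F - r\<^sup>2 * G / 2)) = (\<integral>\<^sup>+h. ennreal (F - r\<^sup>2 * G / 2) * indicator (ball 0 r) h \<partial>(lborel :: (real^'n) measure))"
        using vol True e by (subst nn_integral_cmult_indicator) (auto simp: ennreal_mult mult.commute)
      also have "\<dots> \<le> (\<integral>\<^sup>+h. (\<integral>\<^sup>+x. ennreal \<bar>f x\<bar> * ennreal \<bar>f (x + h)\<bar> \<partial>lborel) \<partial>lborel)"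
      proof (rule nn_integral_mono)
        fix h :: "real^'n"
        show "ennreal (F - r\<^sup>2 * G / 2) * indicator (ball 0 r) h \<le> (\<integral>\<^sup>+x. ennreal \<bar>f x\<bar> * ennreal \<bar>f (x + h)\<bar> \<partial>lborel)"
        proof (cases "h \<in> ball 0 r")
          case True
          have "ennreal (F - r\<^sup>2 * G / 2) \<le> ennreal (\<integral>x. \<bar>f x\<bar> * \<bar>f (x + h)\<bar> \<partial>lborel)"
            using psi[OF True] by (rule ennreal_leI)
          also have "\<dots> = (\<integral>\<^sup>+x. ennreal (\<bar>f x\<bar> * \<bar>f (x + h)\<bar>) \<partial>lborel)"
            using psi_int[OF True] by (subst nn_integral_eq_integral) auto
          finally show ?thesis using True by (simp add: ennreal_mult)
        qed simp
      qed
      also have "\<dots> = (\<integral>\<^sup>+x. (\<integral>\<^sup>+h. ennreal \<bar>f x\<bar> * ennreal \<bar>f (x + h)\<bar> \<partial>lborel) \<partial>lborel)"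
        by (rule lborel_pair.Fubini') measurable
      also have "\<dots> = (\<integral>\<^sup>+x. ennreal \<bar>f x\<bar> * ennreal L \<partial>lborel)"
      proof (rule nn_integral_cong)
        fix x
        have "(\<integral>\<^sup>+h. ennreal \<bar>f x\<bar> * ennreal \<bar>f (x + h)\<bar> \<partial>lborel) = ennreal \<bar>f x\<bar> * (\<integral>\<^sup>+h. ennreal \<bar>f (h + x)\<bar> \<partial>lborel)"
          by (subst nn_integral_cmult[symmetric]) (auto simp: add.commute)
        also have "(\<integral>\<^sup>+h. ennreal \<bar>f (h + x)\<bar> \<partial>lborel) = (\<integral>\<^sup>+h. ennreal \<bar>f h\<bar> \<partial>lborel)"
          by (rule nn_integral_lborel_translation[of "\<lambda>h. ennreal \<bar>f h\<bar>"]) simp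
        also have "\<dots> = ennreal L"
          unfolding L_def using int(1) by (intro nn_integral_eq_integral) auto
        finally show "(\<integral>\<^sup>+h. ennreal \<bar>f x\<bar> * ennreal \<bar>f (x + h)\<bar> \<partial>lborel) = ennreal \<bar>f x\<bar> * ennreal L" .
      qed
      also have "\<dots> = (\<integral>\<^sup>+x. ennreal \<bar>f x\<bar> \<partial>lborel) * ennreal L"
        by (rule nn_integral_multc) simp
      also have "(\<integral>\<^sup>+x. ennreal \<bar>f x\<bar> \<partial>lborel) = ennreal L"
        unfolding L_def using int(1) by (intro nn_integral_eq_integral) auto
      finally show ?thesis
        using L by (simp add: ennreal_mult[symmetric] power2_eq_square)
    qed
    \<comment> \<open>The ball has volume 2 e while L^2 <= e F, so one of the two copies of e F is
      absorbed and the other survives.\<close>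
    with LF have "e * (2 * F - r\<^sup>2 * G) \<le> e * F" by (simp add: algebra_simps)
    then have "F \<le> r\<^sup>2 * G" using e by simp
    moreover have "r\<^sup>2 = (2 * e / w) powr (2 / n)"
      using e w r unfolding r_def by (subst powr_realpow[symmetric]) (auto simp: powr_powr)
    ultimately show ?thesis by (simp add: F_def G_def e_def w_def n_def)
  qed
qed

section \<open>The Sobolev inequality\<close>

text \<open>At the junction 0 the difference quotient is at most \<bar>h\<bar>, so the two branches
  fit together with derivative 0. This is the building block of the cut-off.\<close>

lemma has_real_derivative_power2_pos_part:
  "((\<lambda>t. (max 0 t)\<^sup>2) has_real_derivative 2 * max 0 t) (at t)"
proof -
  consider "t > 0" | "t < 0" | "t = 0" by linarith
  then show ?thesis
  proof cases
    case 1
    have "((\<lambda>t. t\<^sup>2) has_real_derivative 2 * max 0 t) (at t)"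
      using 1 by (auto intro!: derivative_eq_intros)
    then show ?thesis
      by (rule has_field_derivative_transform_within_open[where S="{0<..}"]) (use 1 in auto)
  next
    case 2
    have "((\<lambda>t. 0) has_real_derivative 2 * max 0 t) (at t)"
      using 2 by (auto intro!: derivative_eq_intros)
    then show ?thesis
      by (rule has_field_derivative_transform_within_open[where S="{..<0}"]) (use 2 in auto)
  next
    case 3
    have "(\<lambda>h. ((max 0 (0 + h))\<^sup>2 - (max 0 0)\<^sup>2) / h) \<midarrow>0\<rightarrow> (0::real)"
    proof (rule Lim_null_comparison)
      show "\<forall>\<^sub>F h in at 0. norm (((max 0 (0 + h))\<^sup>2 - (max 0 0)\<^sup>2) / h) \<le> \<bar>h::real\<bar>"
        by (intro always_eventually) (auto simp: max_def power2_eq_square)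
      show "(\<lambda>h::real. \<bar>h\<bar>) \<midarrow>0\<rightarrow> 0"
        using tendsto_rabs_zero[OF tendsto_ident_at] by simp
    qed
    then show ?thesis using 3 by (simp add: DERIV_def)
  qed
qed

text \<open>A quadratic spline: the second difference of the squared positive part.\<close>

lemma C1_step_function:
  obtains T T' :: "real \<Rightarrow> real" where
    "\<And>t. (T has_real_derivative T' t) (at t)" "continuous_on UNIV T'"
    "\<And>t. t \<le> 0 \<Longrightarrow> T t = 0" "\<And>t. t \<ge> 1 \<Longrightarrow> T t = 1"
    "\<And>t. \<bar>T' t\<bar> \<le> 2" "\<And>t. t < 0 \<or> t > 1 \<Longrightarrow> T' t = 0"
proof -
  define P where "P t = (max 0 t)\<^sup>2" for t :: real
  have P: "(P has_real_derivative 2 * max 0 t) (at t)" for t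
    using has_real_derivative_power2_pos_part by (simp add: P_def[abs_def])
  \<comment> \<open>For t >= 1 the second difference with step 1/2 is constantly 1/2, hence the
    factor 2. The derivative is a hat on [0, 1] with peak 2 at t = 1/2.\<close>
  define T where "T t = 2 * (P t - 2 * P (t - 1/2) + P (t - 1))" for t
  define T' where "T' t = 4 * (max 0 t - 2 * max 0 (t - 1/2) + max 0 (t - 1))" for t :: real
  show thesis
  proof (rule that[of T T'])
    fix t
    have sh: "((\<lambda>t. P (t - c)) has_real_derivative 2 * max 0 (t - c)) (at t)" for c
    proof -
      have "((\<lambda>t. t - c) has_real_derivative 1) (at t)"
        by (auto intro!: derivative_eq_intros)
      from DERIV_chain2[OF P this] show ?thesis by simp
    qed
    show "(T has_real_derivative T' t) (at t)"
      unfolding T_def[abs_def] T'_def by (rule derivative_eq_intros P sh refl)+ simp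
    show "T t = 0" if "t \<le> 0" using that by (simp add: T_def P_def)
    show "T t = 1" if "t \<ge> 1" using that by (simp add: T_def P_def max_def power2_eq_square algebra_simps)
    show "\<bar>T' t\<bar> \<le> 2" by (auto simp: T'_def max_def)
    show "T' t = 0" if "t < 0 \<or> t > 1" using that by (auto simp: T'_def max_def)
  next
    show "continuous_on UNIV T'" unfolding T'_def by (intro continuous_intros)
  qed
qed

lemma level_set_measurable:
  fixes f :: "real^'n \<Rightarrow> real"
  assumes f: "C1_cc f" and "s > 0"
  shows "{x. s < (f x)\<^sup>2} \<in> sets borel" "{x. s \<le> (f x)\<^sup>2} \<in> sets borel"
    "emeasure lborel {x. s < (f x)\<^sup>2} < \<infinity>" "emeasure lborel {x. s \<le> (f x)\<^sup>2} < \<infinity>"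
proof -
  note [measurable] = C1_cc_borel[OF f]
  show "{x. s < (f x)\<^sup>2} \<in> sets borel" "{x. s \<le> (f x)\<^sup>2} \<in> sets borel"
    by measurable
  obtain R where R: "\<And>x. norm x > R \<Longrightarrow> f x = 0" using C1_cc_support[OF f] by blast
  have "bounded {x. s < (f x)\<^sup>2}" "bounded {x. s \<le> (f x)\<^sup>2}"
    using R \<open>s > 0\<close> by (auto intro!: boundedI[of _ R] simp: not_less[symmetric])
  then show "emeasure lborel {x. s < (f x)\<^sup>2} < \<infinity>" "emeasure lborel {x. s \<le> (f x)\<^sup>2} < \<infinity>"
    using emeasure_bounded_finite by blast+
qed

text \<open>The Faber--Krahn inequality for a \<open>C\<^sup>1\<close> truncation of \<open>f\<^sup>2\<close> between the levels
  \<open>s\<close> and \<open>2 s\<close>.\<close>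

lemma level_set_estimate:
  fixes f :: "real^'n \<Rightarrow> real"
  assumes f: "C1_cc f" and s: "s > 0"
  shows "measure lborel {x. 2 * s \<le> (f x)\<^sup>2}
    \<le> (2 * measure lborel {x. s < (f x)\<^sup>2} / unit_ball_vol (real CARD('n))) powr (2 / real CARD('n))
      * (32 / s * (\<integral>x. indicator {x. s \<le> (f x)\<^sup>2 \<and> (f x)\<^sup>2 \<le> 2 * s} x * (norm (grad f x))\<^sup>2 \<partial>lborel))"
proof -
  note [measurable] = C1_cc_borel[OF f]
  obtain R where R: "\<And>x. norm x > R \<Longrightarrow> f x = 0" using C1_cc_support[OF f] by blast
  obtain T T' where T: "\<And>t. (T has_real_derivative T' t) (at t)" "continuous_on UNIV T'"
    "\<And>t. t \<le> 0 \<Longrightarrow> T t = 0" "\<And>t. t \<ge> 1 \<Longrightarrow> T t = 1"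
    "\<And>t. \<bar>T' t\<bar> \<le> 2" "\<And>t. t < 0 \<or> t > 1 \<Longrightarrow> T' t = 0"
    using C1_step_function by blast
  define g where "g x = T ((f x)\<^sup>2 / s - 1)" for x
  define c where "c x = T' ((f x)\<^sup>2 / s - 1) * (2 * f x / s)" for x
  define A where "A = {x. s \<le> (f x)\<^sup>2 \<and> (f x)\<^sup>2 \<le> 2 * s}"
  have g': "(g has_derivative (\<lambda>v. (c x *\<^sub>R grad f x) \<bullet> v)) (at x)" for x
  proof -
    have "((\<lambda>x. (f x)\<^sup>2 / s - 1) has_derivative (\<lambda>v. 2 * f x / s * (grad f x \<bullet> v))) (at x)"
      using s by (auto intro!: derivative_eq_intros C1_cc_has_derivative[OF f] simp: fun_eq_iff)
    from has_derivative_compose[OF this T(1)[unfolded has_field_derivative_def]]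
    show ?thesis by (simp add: g_def[abs_def] c_def mult.assoc)
  qed
  have contc: "continuous_on UNIV (\<lambda>x. c x *\<^sub>R grad f x)"
    unfolding c_def
    by (intro continuous_intros continuous_on_compose2[OF T(2)] C1_cc_continuous[OF f]
        C1_cc_grad_continuous[OF f]) (use s in auto)
  have g: "C1_cc g"
    by (rule C1_ccI[OF g' contc, of "cball 0 R"]) (use R T(3) in \<open>auto simp: g_def not_le\<close>)
  note [measurable] = C1_cc_borel[OF g]
  have grad_g: "grad g x = c x *\<^sub>R grad f x" for x
    by (rule grad_unique[OF g'])
  have "measure lborel {x. 2 * s \<le> (f x)\<^sup>2} = (\<integral>x. indicator {x. 2 * s \<le> (f x)\<^sup>2} x \<partial>lborel)"
    by simp
  also have "\<dots> \<le> (\<integral>x. (g x)\<^sup>2 \<partial>lborel)"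
  proof (rule integral_mono')
    show "indicator {x. 2 * s \<le> (f x)\<^sup>2} x \<le> (g x)\<^sup>2" for x
    proof (cases "2 * s \<le> (f x)\<^sup>2")
      case True
      then have "(f x)\<^sup>2 / s - 1 \<ge> 1" using s by (simp add: field_simps)
      then show ?thesis using T(4) by (simp add: g_def)
    qed auto
  qed (use integrable_power2_C1_cc[OF g] in auto)
  also have "\<dots> \<le> (2 * measure lborel {x. s < (f x)\<^sup>2} / unit_ball_vol (real CARD('n))) powr (2 / real CARD('n))
      * (\<integral>x. (norm (grad g x))\<^sup>2 \<partial>lborel)"
  proof (rule Faber_Krahn[OF g level_set_measurable(1,3)[OF f s]])
    fix x assume "x \<notin> {x. s < (f x)\<^sup>2}"
    then have "(f x)\<^sup>2 / s - 1 \<le> 0" using s by (simp add: field_simps)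
    then show "g x = 0" using T(3) by (simp add: g_def)
  qed
  also have "(\<integral>x. (norm (grad g x))\<^sup>2 \<partial>lborel) \<le> (\<integral>x. 32 / s * (indicator A x * (norm (grad f x))\<^sup>2) \<partial>lborel)"
  proof (rule integral_mono')
    have [measurable]: "A \<in> sets borel" unfolding A_def by measurable
    show "integrable lborel (\<lambda>x. 32 / s * (indicator A x * (norm (grad f x))\<^sup>2))"
      by (intro integrable_mult_right integrable_mult_indicator[of A lborel "\<lambda>x. (norm (grad f x))\<^sup>2", unfolded real_scaleR_def]
          integrable_power2_C1_cc[OF f]) simp
    show "(norm (grad g x))\<^sup>2 \<le> 32 / s * (indicator A x * (norm (grad f x))\<^sup>2)" for x
    proof (cases "x \<in> A")
      case True
      have "(c x)\<^sup>2 = \<bar>T' ((f x)\<^sup>2 / s - 1)\<bar>\<^sup>2 * (4 * (f x)\<^sup>2 / s\<^sup>2)"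
        by (simp add: c_def power2_eq_square)
      \<comment> \<open>The constant 32: a factor 4 from \<bar>T'\<bar> <= 2, and (2 f / s)^2 <= 8 /
        s because f^2 <= 2 s on \<open>A\<close>.\<close>
      also have "\<dots> \<le> 2\<^sup>2 * (4 * (2 * s) / s\<^sup>2)"
        using True s by (intro mult_mono power_mono T(5) divide_right_mono) (auto simp: A_def)
      also have "\<dots> = 32 / s" using s by (simp add: power2_eq_square)
      finally have "(c x)\<^sup>2 * (norm (grad f x))\<^sup>2 \<le> 32 / s * (norm (grad f x))\<^sup>2"
        by (rule mult_right_mono) simp
      then show ?thesis using True by (simp add: grad_g power_mult_distrib)
    next
      case False
      then have "(f x)\<^sup>2 / s - 1 < 0 \<or> (f x)\<^sup>2 / s - 1 > 1" using s by (auto simp: A_def field_simps)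
      then show ?thesis using T(6) False by (simp add: grad_g c_def)
    qed
  qed (use s in auto)
  also have "(\<integral>x. 32 / s * (indicator A x * (norm (grad f x))\<^sup>2) \<partial>lborel)
      = 32 / s * (\<integral>x. indicator A x * (norm (grad f x))\<^sup>2 \<partial>lborel)"
    by (rule integral_mult_right_zero)
  finally show ?thesis by (simp add: A_def mult_left_mono)
qed

text \<open>Maz'ya's truncation argument over the levels \<open>s j = S / 4^j\<close>, with \<open>S \<ge> sup f\<^sup>2\<close>.\<close>

lemma Sobolev_C1_cc:
  assumes n3: "CARD('n) \<ge> 3"
  obtains K where "K \<ge> 0"
    "\<And>f :: real^'n \<Rightarrow> real. C1_cc f \<Longrightarrow>
      (\<integral>x. \<bar>f x\<bar> powr (2 * real CARD('n) / (real CARD('n) - 2)) \<partial>lborel)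
          powr ((real CARD('n) - 2) / (2 * real CARD('n)))
      \<le> K * (\<integral>x. (norm (grad f x))\<^sup>2 \<partial>lborel) powr (1/2)"
proof -
  define n where "n = real CARD('n)"
  have n: "n \<ge> 3" using n3 by (simp add: n_def)
  \<comment> \<open>Half the Sobolev exponent: the levels are those of f^2, and \<bar>f\<bar> to the
    power 2 q is (f^2) to the power q.\<close>
  define q where "q = n / (n - 2)"
  have q: "q > 0" using n by (simp add: q_def)
  define w where "w = unit_ball_vol n"
  have w: "w > 0" using n by (simp add: w_def)
  \<comment> \<open>Collected from the recursion below: 4 powr q from passing from
    \<open>s j\<close> to \<open>s (Suc j)\<close>, 32 from the truncated gradient, the rest from
    Faber--Krahn. The further factor in \<open>D\<close> comes from replacing f^2 by its level,
    which costs 4 powr q under the integral.\<close>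
  define C where "C = 4 powr q * 32 * (2 / w) powr (2 / n)"
  have C: "C > 0" using w by (simp add: C_def)
  define D where "D = (4 powr q) powr ((n - 2) / n) * C"
  have D: "D > 0" using C by (simp add: D_def)
  have main: "(\<integral>x. \<bar>f x\<bar> powr (2 * q) \<partial>lborel) powr ((n - 2) / n) \<le> D * (\<integral>x. (norm (grad f x))\<^sup>2 \<partial>lborel)"
    if f: "C1_cc f" for f :: "real^'n \<Rightarrow> real"
  proof -
    note [measurable] = C1_cc_borel[OF f]
    obtain M where M: "M > 0" "\<And>x. \<bar>f x\<bar> \<le> M" using C1_cc_bound[OF f] by blast
    obtain R where R: "\<And>x. norm x > R \<Longrightarrow> f x = 0" using C1_cc_support[OF f] by blast
    \<comment> \<open>The ratio is 4 rather than 2 so that the bands \<open>A j\<close>, from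
      \<open>s j\<close> to 2 \<open>s j\<close>, are pairwise disjoint and their energies add up to
      at most \<open>Gt\<close>.\<close>
    define s where "s j = M\<^sup>2 / 4 ^ j" for j :: nat
    have s: "s j > 0" "s j = 4 * s (Suc j)" for j using M(1) by (simp_all add: s_def)
    define e where "e j = measure lborel {x. s j < (f x)\<^sup>2}" for j
    define A where "A j = {x. s j \<le> (f x)\<^sup>2 \<and> (f x)\<^sup>2 \<le> 2 * s j}" for j
    define G where "G j = (\<integral>x. indicator (A j) x * (norm (grad f x))\<^sup>2 \<partial>lborel)" for j
    define m where "m j = s j powr q * e j" for j
    define Gt where "Gt = (\<integral>x. (norm (grad f x))\<^sup>2 \<partial>lborel)"
    have A_meas [measurable]: "A j \<in> sets borel" for j unfolding A_def by measurable
    have pos: "e j \<ge> 0" "m j \<ge> 0" "G j \<ge> 0" for j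
      by (auto simp: e_def m_def G_def intro!: integral_nonneg)
    have Gt: "Gt \<ge> 0" by (simp add: Gt_def)
    have step: "m j \<le> C * (m (Suc j) powr (2 / n) * G (Suc j))" for j
    proof -
      let ?s = "s (Suc j)"
      have "e j \<le> measure lborel {x. 2 * ?s \<le> (f x)\<^sup>2}"
        unfolding e_def using s(1)[of "Suc j"] s(2)[of j] level_set_measurable[OF f, of "2 * ?s"]
          level_set_measurable[OF f, of "s j"]
        by (intro measure_mono_fmeasurable) (auto simp: fmeasurable_def)
      also have "\<dots> \<le> (2 * e (Suc j) / w) powr (2 / n) * (32 / ?s * G (Suc j))"
        using level_set_estimate[OF f s(1)[of "Suc j"]] by (simp add: e_def w_def n_def G_def A_def)
      finally have "m j \<le> s j powr q * ((2 * e (Suc j) / w) powr (2 / n) * (32 / ?s * G (Suc j)))"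
        unfolding m_def by (rule mult_left_mono) simp
      also have "\<dots> = (4 powr q * ?s powr q) * ((2 / w) powr (2 / n) * e (Suc j) powr (2 / n) * (32 / ?s * G (Suc j)))"
        using s(1)[of "Suc j"] w pos by (simp add: s(2)[of j] powr_mult[symmetric])
      also have "\<dots> = C * ((?s powr q / ?s * e (Suc j) powr (2 / n)) * G (Suc j))"
        using s(1)[of "Suc j"] by (simp add: C_def)
      \<comment> \<open>The Sobolev exponent is the one with q - 1 = q * (2 / n). Thus the leftover
        power of the level combines with the power of \<open>e\<close> into a power of
        \<open>m\<close>, and the recursion is free of the level.\<close>
      also have "?s powr q / ?s = (?s powr q) powr (2 / n)"
      proof -
        have "?s powr q / ?s = ?s powr (q - 1)" using s(1)[of "Suc j"] by (simp add: powr_diff)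
        also have "q - 1 = q * (2 / n)" using n by (simp add: q_def field_simps)
        finally show ?thesis by (simp add: powr_powr)
      qed
      also have "(?s powr q) powr (2 / n) * e (Suc j) powr (2 / n) = m (Suc j) powr (2 / n)"
        using pos by (simp add: m_def powr_mult)
      finally show ?thesis .
    qed
    have sumG: "(\<Sum>j<N. G (Suc j)) \<le> Gt" for N
    proof -
      have intG: "integrable lborel (\<lambda>x. indicator (A j) x * (norm (grad f x))\<^sup>2)" for j
        using integrable_mult_indicator[of "A j" lborel "\<lambda>x. (norm (grad f x))\<^sup>2"]
          integrable_power2_C1_cc[OF f] by simp
      have disj: "(\<Sum>j<N. indicator (A (Suc j)) x) \<le> (1::real)" for x
      proof -
        have "i = j" if "x \<in> A i" "x \<in> A j" "i \<le> j" for i j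
        proof (rule ccontr)
          assume "i \<noteq> j"
          then have "Suc i \<le> j" using that by simp
          then have "s j \<le> s (Suc i)"
            unfolding s_def by (intro divide_left_mono power_increasing) auto
          then show False using that s(1)[of "Suc i"] s(2)[of i] unfolding A_def by auto
        qed
        then have "card {j\<in>{..<N}. x \<in> A (Suc j)} \<le> Suc 0"
          by (subst card_le_Suc0_iff_eq) (auto, metis Suc_inject nat_le_linear)
        then show ?thesis by (simp add: indicator_def sum.If_cases Int_def)
      qed
      have "(\<Sum>j<N. G (Suc j)) = (\<integral>x. (\<Sum>j<N. indicator (A (Suc j)) x * (norm (grad f x))\<^sup>2) \<partial>lborel)"
        unfolding G_def using intG by (subst Bochner_Integration.integral_sum) auto
      also have "\<dots> \<le> Gt"
        unfolding Gt_def
      proof (rule integral_mono')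
        show "(\<Sum>j<N. indicator (A (Suc j)) x * (norm (grad f x))\<^sup>2) \<le> (norm (grad f x))\<^sup>2" for x
          unfolding sum_distrib_right[symmetric] using mult_right_mono[OF disj, of "(norm (grad f x))\<^sup>2"] by simp
      qed (use integrable_power2_C1_cc[OF f] in auto)
      finally show ?thesis .
    qed
    \<comment> \<open>Finiteness of the sum has to be known before it can be absorbed. It follows
      from the bounded support: all \<open>e j\<close> are at most the volume of one ball, and the
      powers of the levels are geometric.\<close>
    have m_summable: "summable m"
    proof (rule summable_comparison_test')
      let ?V = "measure lborel (cball (0::real^'n) R)"
      show "summable (\<lambda>j. (M\<^sup>2) powr q * ?V * (1 / 4 powr q) ^ j)"
        using q by (intro summable_mult summable_geometric) (simp add: divide_less_eq)
      show "norm (m j) \<le> (M\<^sup>2) powr q * ?V * (1 / 4 powr q) ^ j" for j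
      proof -
        have "s j powr q = (M\<^sup>2) powr q * (1 / 4 powr q) ^ j"
          by (simp add: s_def powr_divide power_divide powr_realpow[symmetric] powr_powr mult.commute)
        moreover have "e j \<le> ?V"
          unfolding e_def
        proof (rule measure_mono_fmeasurable)
          show "{x. s j < (f x)\<^sup>2} \<subseteq> cball 0 R"
            using R s(1)[of j] by (auto simp: not_less[symmetric])
        qed (use level_set_measurable[OF f s(1)[of j]] in \<open>auto intro!: fmeasurable_compact\<close>)
        ultimately show ?thesis
          using pos[of j] mult_left_mono[of "e j" ?V "s j powr q"] by (simp add: m_def mult_ac)
      qed
    qed
    define Z where "Z = suminf m"
    have m_le: "m j \<le> Z" for j
      unfolding Z_def using sum_le_suminf[OF m_summable, of "{j}"] pos by auto
    have Z: "Z \<ge> 0" unfolding Z_def using pos by (intro suminf_nonneg[OF m_summable])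
    \<comment> \<open>In the recursion each \<open>m (Suc j)\<close> is replaced by the whole sum
      \<open>Z\<close>, which leaves only the energies of the disjoint bands to be summed.\<close>
    have "Z \<le> C * (Z powr (2 / n) * Gt)"
      unfolding Z_def
    proof (rule suminf_le_const[OF m_summable])
      fix N
      have "(\<Sum>j<N. m j) \<le> (\<Sum>j<N. C * (Z powr (2 / n) * G (Suc j)))"
      proof (rule sum_mono)
        fix j
        have "m (Suc j) powr (2 / n) \<le> Z powr (2 / n)"
          using n pos m_le by (intro powr_mono2) auto
        then show "m j \<le> C * (Z powr (2 / n) * G (Suc j))"
          using step[of j] C pos by (smt (verit) mult_left_mono mult_right_mono)
      qed
      also have "\<dots> = C * (Z powr (2 / n) * (\<Sum>j<N. G (Suc j)))"
        by (simp add: sum_distrib_left)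
      also have "\<dots> \<le> C * (Z powr (2 / n) * Gt)"
        using C sumG by (intro mult_left_mono) auto
      finally show "sum m {..<N} \<le> C * (suminf m powr (2 / n) * Gt)" by (simp add: Z_def)
    qed
    then have Z_bound: "Z powr ((n - 2) / n) \<le> C * Gt"
    proof (cases "Z = 0")
      case False
      then have Zp: "Z > 0" using Z by simp
      have "(n - 2) / n = 1 - 2 / n" using n by (simp add: field_simps)
      then have "Z powr ((n - 2) / n) = Z / Z powr (2 / n)"
        using Zp by (simp add: powr_diff)
      also have "\<dots> \<le> C * Gt"
        using \<open>Z \<le> C * (Z powr (2 / n) * Gt)\<close> Zp by (simp add: divide_le_eq mult_ac)
      finally show ?thesis .
    qed (use C Gt in auto)
    \<comment> \<open>Of the series only the term of the first level below (f x)^2 is kept. That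
      level has a predecessor, since level 0 is the square of the bound \<open>M\<close>; the
      predecessor is 4 \<open>s j\<close> and is not below (f x)^2.\<close>
    have pw: "ennreal (\<bar>f x\<bar> powr (2 * q)) \<le> ennreal (4 powr q) * (\<Sum>j. ennreal (s j powr q) * indicator {x. s j < (f x)\<^sup>2} x)" for x
    proof (cases "f x = 0")
      case False
      have "(\<lambda>j. M\<^sup>2 * (1 / 4) ^ j) \<longlonglongrightarrow> M\<^sup>2 * 0"
        by (intro tendsto_intros LIMSEQ_power_zero) auto
      then have "(\<lambda>j. s j) \<longlonglongrightarrow> 0" by (simp add: s_def power_divide)
      moreover have "(f x)\<^sup>2 > 0" using False by simp
      ultimately have "\<exists>j. s j < (f x)\<^sup>2"
        using order_tendstoD(2) eventually_happens trivial_limit_sequentially by metis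
      define j where "j = (LEAST j. s j < (f x)\<^sup>2)"
      have j: "s j < (f x)\<^sup>2" unfolding j_def by (rule LeastI_ex) fact
      have "j \<noteq> 0"
      proof
        assume "j = 0"
        then show False using j power_mono[OF M(2)[of x], of 2] by (simp add: s_def)
      qed
      then obtain i where i: "j = Suc i" by (cases j) auto
      then have "\<not> s i < (f x)\<^sup>2" using not_less_Least[of i "\<lambda>j. s j < (f x)\<^sup>2"] by (simp add: j_def)
      then have "(f x)\<^sup>2 \<le> 4 * s j" using s(2)[of i] i by simp
      then have "((f x)\<^sup>2) powr q \<le> (4 * s j) powr q" using q by (intro powr_mono2) auto
      moreover have "\<bar>f x\<bar> powr (2 * q) = ((f x)\<^sup>2) powr q"
        using False by (simp add: powr_powr[symmetric] powr_numeral power2_abs)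
      ultimately have "ennreal (\<bar>f x\<bar> powr (2 * q)) \<le> ennreal (4 powr q) * ennreal (s j powr q)"
        using s(1)[of j] by (simp add: ennreal_mult[symmetric] powr_mult)
      also have "ennreal (s j powr q) = (\<Sum>i\<in>{j}. ennreal (s i powr q) * indicator {x. s i < (f x)\<^sup>2} x)"
        using j by simp
      also have "\<dots> \<le> (\<Sum>j. ennreal (s j powr q) * indicator {x. s j < (f x)\<^sup>2} x)"
        by (rule sum_le_suminf) auto
      finally show ?thesis by (simp add: mult_left_mono)
    qed simp
    have "(\<integral>x. \<bar>f x\<bar> powr (2 * q) \<partial>lborel) \<le> 4 powr q * Z"
    proof (rule integral_real_bounded)
      have "(\<integral>\<^sup>+x. ennreal (\<bar>f x\<bar> powr (2 * q)) \<partial>lborel)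
        \<le> (\<integral>\<^sup>+x. ennreal (4 powr q) * (\<Sum>j. ennreal (s j powr q) * indicator {x. s j < (f x)\<^sup>2} x) \<partial>lborel)"
        by (rule nn_integral_mono) (rule pw)
      also have "\<dots> = ennreal (4 powr q) * (\<integral>\<^sup>+x. (\<Sum>j. ennreal (s j powr q) * indicator {x. s j < (f x)\<^sup>2} x) \<partial>lborel)"
        by (rule nn_integral_cmult) measurable
      also have "(\<integral>\<^sup>+x. (\<Sum>j. ennreal (s j powr q) * indicator {x. s j < (f x)\<^sup>2} x) \<partial>lborel)
        = (\<Sum>j. \<integral>\<^sup>+x. ennreal (s j powr q) * indicator {x. s j < (f x)\<^sup>2} x \<partial>lborel)"
        by (rule nn_integral_suminf) measurable
      also have "\<dots> = (\<Sum>j. ennreal (m j))"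
      proof (rule suminf_cong)
        fix j
        show "(\<integral>\<^sup>+x. ennreal (s j powr q) * indicator {x. s j < (f x)\<^sup>2} x \<partial>lborel) = ennreal (m j)"
          using level_set_measurable[OF f s(1)[of j]]
          by (subst nn_integral_cmult_indicator)
             (auto simp: m_def e_def ennreal_mult emeasure_eq_ennreal_measure less_top[symmetric])
      qed
      also have "\<dots> = ennreal Z"
        unfolding Z_def using pos m_summable by (intro suminf_ennreal2) auto
      finally show "(\<integral>\<^sup>+x. ennreal (\<bar>f x\<bar> powr (2 * q)) \<partial>lborel) \<le> ennreal (4 powr q * Z)"
        using Z by (simp add: ennreal_mult)
    qed (use Z in auto)
    then have "(\<integral>x. \<bar>f x\<bar> powr (2 * q) \<partial>lborel) powr ((n - 2) / n) \<le> (4 powr q * Z) powr ((n - 2) / n)"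
      using n by (intro powr_mono2) auto
    also have "\<dots> = (4 powr q) powr ((n - 2) / n) * Z powr ((n - 2) / n)"
      using Z by (simp add: powr_mult)
    also have "\<dots> \<le> (4 powr q) powr ((n - 2) / n) * (C * Gt)"
      using Z_bound by (intro mult_left_mono) auto
    finally show ?thesis by (simp add: D_def Gt_def mult_ac)
  qed
  show thesis
  proof (rule that[of "sqrt D"])
    fix f :: "real^'n \<Rightarrow> real" assume f: "C1_cc f"
    let ?L = "\<integral>x. \<bar>f x\<bar> powr (2 * q) \<partial>lborel" and ?G = "\<integral>x. (norm (grad f x))\<^sup>2 \<partial>lborel"
    have "?L powr ((n - 2) / (2 * n)) = (?L powr ((n - 2) / n)) powr (1 / 2)"
      by (simp add: powr_powr mult.commute)
    also have "\<dots> \<le> (D * ?G) powr (1 / 2)"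
      using main[OF f] by (intro powr_mono2) auto
    also have "\<dots> = sqrt D * ?G powr (1 / 2)"
      using D by (simp add: powr_mult powr_half_sqrt)
    finally show "(\<integral>x. \<bar>f x\<bar> powr (2 * real CARD('n) / (real CARD('n) - 2)) \<partial>lborel)
          powr ((real CARD('n) - 2) / (2 * real CARD('n)))
      \<le> sqrt D * ?G powr (1/2)"
      by (simp add: q_def n_def)
  qed (use D in simp)
qed

section \<open>Test functions and singular weights\<close>

text \<open>The infimum is itself admissible: if G f > 0, then L f / G f is a lower bound for all
  admissible constants; if G f = 0, any one admissible constant forces L f <= 0.
  \<open>Sobolev_C1_cc\<close> supplies the non-emptiness on which both \<open>Inf\<close> arguments
  depend.\<close>

lemma sobolev_K_inequality:
  fixes f :: "real^'n \<Rightarrow> real"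
  assumes n3: "CARD('n) \<ge> 3" and f: "smooth_cc f"
  shows "(\<integral>x. \<bar>f x\<bar> powr (2 * real CARD('n) / (real CARD('n) - 2)) \<partial>lborel)
          powr ((real CARD('n) - 2) / (2 * real CARD('n)))
      \<le> sobolev_K TYPE('n) * (\<integral>x. (norm (grad f x))\<^sup>2 \<partial>lborel) powr (1/2)"
    and "sobolev_K TYPE('n) \<ge> 0"
proof -
  define L where "L g = (\<integral>x. \<bar>g x\<bar> powr (2 * real CARD('n) / (real CARD('n) - 2)) \<partial>lborel)
          powr ((real CARD('n) - 2) / (2 * real CARD('n)))" for g :: "real^'n \<Rightarrow> real"
  define G where "G g = (\<integral>x. (norm (grad g x))\<^sup>2 \<partial>lborel) powr (1/2)" for g :: "real^'n \<Rightarrow> real"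
  define S where "S = {K::real. K \<ge> 0 \<and> (\<forall>g. smooth_cc g \<longrightarrow> L g \<le> K * G g)}"
  have K: "sobolev_K TYPE('n) = Inf S"
    unfolding sobolev_K_def S_def L_def G_def using n3 by (simp add: of_nat_diff)
  have "\<exists>K0. K0 \<in> S"
  proof (rule Sobolev_C1_cc[OF n3])
    fix K assume "K \<ge> 0" and "\<And>f :: real^'n \<Rightarrow> real. C1_cc f \<Longrightarrow>
      (\<integral>x. \<bar>f x\<bar> powr (2 * real CARD('n) / (real CARD('n) - 2)) \<partial>lborel)
          powr ((real CARD('n) - 2) / (2 * real CARD('n)))
      \<le> K * (\<integral>x. (norm (grad f x))\<^sup>2 \<partial>lborel) powr (1/2)"
    then have "K \<in> S"
      unfolding S_def L_def G_def using smooth_cc_imp_C1_cc by blast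
    then show ?thesis ..
  qed
  then obtain K0 where "K0 \<in> S" ..
  then have ne: "S \<noteq> {}" by blast
  show "sobolev_K TYPE('n) \<ge> 0"
    unfolding K by (rule cInf_greatest[OF ne]) (simp add: S_def)
  have G: "G f \<ge> 0" by (simp add: G_def)
  have "L f \<le> Inf S * G f"
  proof (cases "G f = 0")
    case True
    then show ?thesis using \<open>K0 \<in> S\<close> f by (auto simp: S_def)
  next
    case False
    with G have "G f > 0" by simp
    have "L f / G f \<le> Inf S"
    proof (rule cInf_greatest[OF ne])
      fix K assume "K \<in> S"
      then have "L f \<le> K * G f" using f by (simp add: S_def)
      then show "L f / G f \<le> K" using \<open>G f > 0\<close> by (simp add: divide_le_eq)
    qed
    then show ?thesis using \<open>G f > 0\<close> by (simp add: divide_le_eq)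
  qed
  then show "(\<integral>x. \<bar>f x\<bar> powr (2 * real CARD('n) / (real CARD('n) - 2)) \<partial>lborel)
          powr ((real CARD('n) - 2) / (2 * real CARD('n)))
      \<le> sobolev_K TYPE('n) * (\<integral>x. (norm (grad f x))\<^sup>2 \<partial>lborel) powr (1/2)"
    by (simp add: K L_def G_def)
qed

section \<open>Calculus of the class \<open>Ck\<close> and smoothness of the regularised
  weights\<close>

lemma Ck_SucI:
  assumes d: "\<And>x. (f has_derivative f' x) (at x)" and "\<And>v. Ck k (\<lambda>x. f' x v)"
  shows "Ck (Suc k) f"
proof -
  have "frechet_derivative f (at x) = f' x" for x
    using frechet_derivative_at[OF d[of x]] by simp
  then show ?thesis using assms has_derivative_imp_differentiable[OF d] by simp
qed

lemma Ck_has_derivative: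
  "Ck (Suc k) f \<Longrightarrow> (f has_derivative frechet_derivative f (at x)) (at x)"
  by (simp add: frechet_derivative_works[symmetric])

lemma Ck_derivative: "Ck (Suc k) f \<Longrightarrow> Ck k (\<lambda>x. frechet_derivative f (at x) v)"
  by simp

text \<open>Serves the product rule, in whose derivative each factor also occurs undifferentiated
  and must then count as a function of the lower class.\<close>

lemma Ck_Suc_imp_Ck: "Ck (Suc k) f \<Longrightarrow> Ck k f"
proof (induction k arbitrary: f)
  case 0
  then show ?case by (auto intro!: continuous_at_imp_continuous_on differentiable_imp_continuous_within)
next
  case (Suc k)
  show ?case
    by (rule Ck_SucI[OF Ck_has_derivative[OF Suc.prems]]) (rule Suc.IH[OF Ck_derivative[OF Suc.prems]])
qed

lemma Ck_const: "Ck k (\<lambda>x. c)"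
proof (induction k arbitrary: c)
  case (Suc k)
  show ?case by (rule Ck_SucI[of _ "\<lambda>_ _. 0"]) (auto intro: Suc)
qed simp

lemma Ck_add: "Ck k f \<Longrightarrow> Ck k g \<Longrightarrow> Ck k (\<lambda>x. f x + g x)"
proof (induction k arbitrary: f g)
  case (Suc k)
  show ?case
    by (rule Ck_SucI[OF has_derivative_add[OF Suc.prems[THEN Ck_has_derivative]]])
       (intro Suc.IH Suc.prems Ck_derivative)
qed (auto intro: continuous_intros)

lemma Ck_mult: "Ck k f \<Longrightarrow> Ck k g \<Longrightarrow> Ck k (\<lambda>x. f x * g x)"
proof (induction k arbitrary: f g)
  case (Suc k)
  show ?case
    by (rule Ck_SucI[OF has_derivative_mult[OF Suc.prems[THEN Ck_has_derivative]]])
       (intro Suc.IH Suc.prems Ck_derivative Ck_add Ck_Suc_imp_Ck)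
qed (auto intro: continuous_intros)

lemma Ck_inner: "Ck k (\<lambda>x. c \<bullet> x)"
proof (cases k)
  case (Suc m)
  then show ?thesis
    by (auto intro!: Ck_SucI[of _ "\<lambda>x v. c \<bullet> v"] Ck_const derivative_eq_intros simp del: Ck.simps)
qed (auto intro: continuous_intros)

lemma weight_has_derivative:
  fixes x :: "'a::real_inner"
  assumes "\<delta> > 0"
  shows "((\<lambda>x. (\<delta> + x \<bullet> x) powr r) has_derivative (\<lambda>v. 2 * r * (\<delta> + x \<bullet> x) powr (r - 1) * (v \<bullet> x))) (at x)"
proof -
  have pos: "\<delta> + x \<bullet> x > 0" using assms by (simp add: add_pos_nonneg)
  have 1: "((\<lambda>x. \<delta> + x \<bullet> x) has_derivative (\<lambda>v. 2 * (v \<bullet> x))) (at x)"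
    by (auto intro!: derivative_eq_intros simp: inner_commute)
  have 2: "((\<lambda>t. t powr r) has_derivative (\<lambda>h. r * (\<delta> + x \<bullet> x) powr (r - 1) * h)) (at (\<delta> + x \<bullet> x))"
    using has_real_derivative_powr[OF pos, of r] by (simp add: has_field_derivative_def)
  show ?thesis using has_derivative_compose[OF 1 2] by (simp add: mult_ac)
qed

text \<open>Each derivative is a linear function times a weight of the same kind with exponent r -
  1, so the induction keeps r arbitrary; \<delta> > 0 keeps the base away from 0.\<close>

lemma Ck_weight: "\<delta> > 0 \<Longrightarrow> Ck k (\<lambda>x. (\<delta> + x \<bullet> x) powr r)"
proof (induction k arbitrary: r)
  case 0
  have "\<delta> + x \<bullet> x \<noteq> 0" for x :: "real^'a"
    using 0 inner_ge_zero[of x] by linarith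
  then show ?case by (auto intro!: continuous_intros)
next
  case (Suc k)
  show ?case
    by (rule Ck_SucI[OF weight_has_derivative[OF Suc.prems]])
       (intro Ck_mult Ck_const Ck_inner Suc)
qed

lemma smooth_cc_mult:
  assumes u: "smooth_cc u" and w: "\<And>k. Ck k w"
  shows "smooth_cc (\<lambda>x. u x * w x)"
proof -
  have "bounded {x. u x \<noteq> 0}"
    using u unfolding smooth_cc_def by (meson bounded_subset closure_subset compact_imp_bounded)
  then have "bounded {x. u x * w x \<noteq> 0}" by (rule bounded_subset) auto
  then show ?thesis
    using u w unfolding smooth_cc_def by (auto simp: compact_closure intro!: Ck_mult)
qed

text \<open>Since \<open>norm x \<ge> \<bar>x\<^sub>i\<bar>\<close>, the weight is dominated by a product of one-dimensional
  powers with exponent \<open>- s / n > - 1\<close>.\<close>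

lemma integrable_norm_powr_cball:
  assumes s: "s < real DIM('a)"
  shows "integrable lborel (\<lambda>x::'a::euclidean_space. indicator (cball 0 R) x * norm x powr (- s))"
proof (cases "s \<le> 0")
  case True
  have [measurable]: "cball (0::'a) R \<in> sets borel" by simp
  show ?thesis
  proof (rule Bochner_Integration.integrable_bound[OF integrable_const_indicator_cball[of "R powr (- s)" R]])
    show "AE x::'a in lborel. norm (indicator (cball 0 R) x * norm x powr (- s))
        \<le> norm (R powr (- s) * indicator (cball 0 R) x)"
      using True by (auto simp: indicator_def intro!: powr_mono2)
  qed measurable
next
  case False
  have [measurable]: "cball (0::'a) R \<in> sets borel" by simp
  define r where "r = s / real DIM('a)"
  have r: "0 < r" "r < 1" using s False by (auto simp: r_def)
  define g where "g = (\<lambda>t::real. ennreal (\<bar>t\<bar> powr (- r)) * indicator {- \<bar>R\<bar>..\<bar>R\<bar>} t)"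
  have g_meas [measurable]: "g \<in> borel_measurable borel" unfolding g_def by measurable
  have half: "(\<integral>\<^sup>+t. ennreal (\<bar>t\<bar> powr (- r)) * indicator {0..\<bar>R\<bar>} t \<partial>lborel) < \<infinity>" (is "?H < _")
  proof -
    have "(\<integral>\<^sup>+t. ennreal (t powr (- r)) * indicator {0..\<bar>R\<bar>} t \<partial>lborel) = ennreal (\<bar>R\<bar> powr (- r + 1) / (- r + 1))"
      using r by (intro nn_integral_has_integral_lebesgue' has_integral_powr_from_0) auto
    moreover have "?H = (\<integral>\<^sup>+t. ennreal (t powr (- r)) * indicator {0..\<bar>R\<bar>} t \<partial>lborel)"
      by (intro nn_integral_cong) (auto simp: indicator_def)
    ultimately show ?thesis by simp
  qed
  have "(\<integral>\<^sup>+t. g t \<partial>lborel) \<le> (\<integral>\<^sup>+t. ennreal (\<bar>t\<bar> powr (- r)) * indicator {0..\<bar>R\<bar>} t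
      + ennreal (\<bar>- t\<bar> powr (- r)) * indicator {0..\<bar>R\<bar>} (- t) \<partial>lborel)"
    unfolding g_def by (intro nn_integral_mono) (auto simp: indicator_def)
  also have "\<dots> = ?H + (\<integral>\<^sup>+t. ennreal (\<bar>- t\<bar> powr (- r)) * indicator {0..\<bar>R\<bar>} (- t) \<partial>lborel)"
    by (rule nn_integral_add) measurable
  also have "(\<integral>\<^sup>+t. ennreal (\<bar>- t\<bar> powr (- r)) * indicator {0..\<bar>R\<bar>} (- t) \<partial>lborel) = ?H"
    using nn_integral_real_affine[of "\<lambda>t. ennreal (\<bar>t\<bar> powr (- r)) * indicator {0..\<bar>R\<bar>} t" "- 1" 0] by simp
  finally have g_fin: "(\<integral>\<^sup>+t. g t \<partial>lborel) < \<infinity>"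
    using half by (simp add: order_le_less_trans)
  \<comment> \<open>On a coordinate hyperplane the convention \<open>0 powr y = 0\<close> makes the
    product vanish, so the domination can fail there; these hyperplanes are null sets.\<close>
  have AE_pos: "AE x in (lborel :: 'a measure). \<forall>b\<in>Basis. x \<bullet> b \<noteq> 0"
    by (intro AE_finite_allI finite_Basis AE_lborel_inner_neq)
  have "(\<integral>\<^sup>+x. ennreal (indicator (cball 0 R) x * norm x powr (- s)) \<partial>(lborel :: 'a measure))
      \<le> (\<integral>\<^sup>+x. (\<Prod>b\<in>Basis. g (x \<bullet> b)) \<partial>(lborel :: 'a measure))"
  proof (rule nn_integral_mono_AE, use AE_pos in eventually_elim)
    fix x :: 'a assume x: "\<forall>b\<in>Basis. x \<bullet> b \<noteq> 0"
    show "ennreal (indicator (cball 0 R) x * norm x powr (- s)) \<le> (\<Prod>b\<in>Basis. g (x \<bullet> b))"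
    proof (cases "norm x \<le> R")
      case True
      have x0: "x \<noteq> 0" using x nonempty_Basis by auto
      have le: "\<bar>x \<bullet> b\<bar> \<le> norm x" if "b \<in> Basis" for b
        by (rule Basis_le_norm[OF that])
      have g_eq: "g (x \<bullet> b) = ennreal (\<bar>x \<bullet> b\<bar> powr (- r))" if "b \<in> Basis" for b
      proof -
        have "x \<bullet> b \<in> {- \<bar>R\<bar>..\<bar>R\<bar>}" using le[OF that] True by auto
        then show ?thesis by (simp add: g_def)
      qed
      have "norm x powr (- s) = (\<Prod>b\<in>(Basis::'a set). norm x powr (- r))"
        using x0 by (simp add: r_def powr_powr flip: powr_realpow)
      also have "\<dots> \<le> (\<Prod>b\<in>Basis. \<bar>x \<bullet> b\<bar> powr (- r))"
        using x r le by (intro prod_mono conjI powr_mono2') auto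
      finally have "ennreal (norm x powr (- s)) \<le> ennreal (\<Prod>b\<in>Basis. \<bar>x \<bullet> b\<bar> powr (- r))"
        by (rule ennreal_leI)
      also have "\<dots> = (\<Prod>b\<in>Basis. ennreal (\<bar>x \<bullet> b\<bar> powr (- r)))"
        by (rule prod_ennreal[symmetric]) simp
      also have "\<dots> = (\<Prod>b\<in>Basis. g (x \<bullet> b))"
        by (rule prod.cong) (simp_all add: g_eq)
      finally show ?thesis using True by simp
    qed simp
  qed
  also have "\<dots> = (\<Prod>b\<in>(Basis::'a set). \<integral>\<^sup>+t. g t \<partial>lborel)"
    by (rule nn_integral_lborel_prod) auto
  also have "\<dots> < \<infinity>"
    using g_fin by (simp add: power_less_top_ennreal)
  finally show ?thesis
    by (intro integrableI_bounded) (auto simp: abs_mult)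
qed

lemma weight_tendsto:
  assumes "x \<noteq> (0::'a::real_inner)" "\<delta> \<longlonglongrightarrow> 0"
  shows "(\<lambda>k. (\<delta> k + x \<bullet> x) powr (- s / 2)) \<longlonglongrightarrow> norm x powr (- s)"
proof -
  have "(\<lambda>k. (\<delta> k + x \<bullet> x) powr (- s / 2)) \<longlonglongrightarrow> (0 + x \<bullet> x) powr (- s / 2)"
    using assms by (intro tendsto_intros) auto
  also have "(0 + x \<bullet> x) powr (- s / 2) = norm x powr (- s)"
    using assms(1) by (simp add: dot_square_norm powr_powr flip: powr_numeral)
  finally show ?thesis .
qed

text \<open>Dominated convergence with a majorant for both signs of s: for s >= 0 the regularised
  weight lies below the singular one, for s < 0 it is at most (1 + R^2) powr (- s / 2) on the
  support. The factor \<phi> may vary with k because differentiating the regularised weights leaves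
  \<delta> in the integrand as well.\<close>

lemma integral_weight_tendsto:
  fixes \<phi> :: "nat \<Rightarrow> 'a::euclidean_space \<Rightarrow> real"
  assumes s: "s < real DIM('a)"
    and meas [measurable]: "\<And>k. \<phi> k \<in> borel_measurable borel" "\<psi> \<in> borel_measurable borel"
    and bound: "\<And>k x. \<bar>\<phi> k x\<bar> \<le> M" "\<And>k x. norm x > R \<Longrightarrow> \<phi> k x = 0"
    and lim: "\<And>x. x \<noteq> 0 \<Longrightarrow> (\<lambda>k. \<phi> k x) \<longlonglongrightarrow> \<psi> x"
    and \<delta>: "\<delta> \<longlonglongrightarrow> 0" "\<And>k. 0 < \<delta> k" "\<And>k. \<delta> k \<le> 1"
  shows "integrable lborel (\<lambda>x. \<psi> x * norm x powr (- s))"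
    and "(\<lambda>k. \<integral>x. \<phi> k x * (\<delta> k + x \<bullet> x) powr (- s / 2) \<partial>lborel)
      \<longlonglongrightarrow> (\<integral>x. \<psi> x * norm x powr (- s) \<partial>lborel)"
proof -
  define B where "B = (1 + R\<^sup>2) powr (- s / 2)"
  define w where "w x = M * (indicator (cball 0 R) x * norm x powr (- s)) + (M * B) * indicator (cball 0 R) x"
    for x :: 'a
  have M: "M \<ge> 0" using bound(1)[of 0 0] by linarith
  have w: "integrable lborel w"
    unfolding w_def
    by (intro Bochner_Integration.integrable_add integrable_mult_right[OF integrable_norm_powr_cball[OF s]]
        integrable_const_indicator_cball)
  have AE0: "AE x::'a in lborel. x \<noteq> 0" by (rule AE_lborel_singleton)
  have lim': "AE x in lborel. (\<lambda>k. \<phi> k x * (\<delta> k + x \<bullet> x) powr (- s / 2)) \<longlonglongrightarrow> \<psi> x * norm x powr (- s)"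
    using AE0 by eventually_elim (intro tendsto_mult lim weight_tendsto \<delta>(1))
  have dom: "AE x in lborel. norm (\<phi> k x * (\<delta> k + x \<bullet> x) powr (- s / 2)) \<le> w x" for k
    using AE0
  proof eventually_elim
    fix x :: 'a assume x: "x \<noteq> 0"
    show "norm (\<phi> k x * (\<delta> k + x \<bullet> x) powr (- s / 2)) \<le> w x"
    proof (cases "norm x \<le> R")
      case True
      have "(\<delta> k + x \<bullet> x) powr (- s / 2) \<le> norm x powr (- s) + B"
      proof (cases "s \<ge> 0")
        case True
        have "(\<delta> k + x \<bullet> x) powr (- s / 2) \<le> (x \<bullet> x) powr (- s / 2)"
          using True x \<delta>(2)[of k] by (intro powr_mono2') auto
        also have "\<dots> = norm x powr (- s)"
          using x by (simp add: dot_square_norm powr_powr flip: powr_numeral)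
        finally show ?thesis by (simp add: B_def add_increasing2)
      next
        case False
        have "x \<bullet> x \<le> R\<^sup>2"
          using power_mono[OF \<open>norm x \<le> R\<close>, of 2] by (simp add: dot_square_norm)
        then have "(\<delta> k + x \<bullet> x) powr (- s / 2) \<le> B"
          
          unfolding B_def using False \<delta>(2,3)[of k] by (intro powr_mono2) (auto intro: add_nonneg_nonneg)
        then show ?thesis by (simp add: add_increasing)
      qed
      then have "\<bar>\<phi> k x\<bar> * (\<delta> k + x \<bullet> x) powr (- s / 2) \<le> M * (norm x powr (- s) + B)"
        using bound(1)[of k x] M by (intro mult_mono) auto
      then show ?thesis using True by (simp add: w_def abs_mult distrib_left)
    next
      case False
      then show ?thesis using bound(2)[of x k] by (simp add: w_def)
    qed
  qed
  have [measurable]: "(\<lambda>x. \<psi> x * norm x powr (- s)) \<in> borel_measurable lborel"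
    "\<And>k. (\<lambda>x. \<phi> k x * (\<delta> k + x \<bullet> x) powr (- s / 2)) \<in> borel_measurable lborel"
    by measurable
  show "integrable lborel (\<lambda>x. \<psi> x * norm x powr (- s))"
    by (rule integrable_dominated_convergence[OF _ _ w lim' dom]) measurable
  show "(\<lambda>k. \<integral>x. \<phi> k x * (\<delta> k + x \<bullet> x) powr (- s / 2) \<partial>lborel)
      \<longlonglongrightarrow> (\<integral>x. \<psi> x * norm x powr (- s) \<partial>lborel)"
    by (rule integral_dominated_convergence[OF _ _ w lim' dom]) measurable
qed

section \<open>Weighted inequalities\<close>

text \<open>Lets a derivative be integrated in whatever form the product rule delivers it, without
  rewriting it as a gradient first.\<close>

lemma integral_has_derivative_eq_0:
  fixes f :: "real^'n \<Rightarrow> real"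
  assumes f: "C1_cc f" and d: "\<And>x. (f has_derivative f' x) (at x)"
  shows "(\<integral>x. f' x v \<partial>lborel) = 0" "integrable lborel (\<lambda>x. f' x v)"
proof -
  have eq: "f' x v = grad f x \<bullet> v" for x
    using has_derivative_unique[OF d C1_cc_has_derivative[OF f]] by metis
  show "(\<integral>x. f' x v \<partial>lborel) = 0"
    unfolding eq by (rule integral_directional_derivative_eq_0[OF f])
  obtain R where R: "\<And>x. norm x > R \<Longrightarrow> f x = 0 \<and> grad f x = 0"
    using C1_cc_support[OF f] by blast
  show "integrable lborel (\<lambda>x. f' x v)"
    unfolding eq
    by (rule integrable_continuous_support[where R=R])
       (use R in \<open>auto intro!: continuous_intros C1_cc_grad_continuous[OF f]\<close>)
qed

lemma C1_cc_bounds: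
  fixes u :: "real^'n \<Rightarrow> real"
  assumes "C1_cc u"
  obtains M R where "M > 0" "R > 0" "\<And>x. \<bar>u x\<bar> \<le> M" "\<And>x. norm (grad u x) \<le> M"
    "\<And>x. norm x > R \<Longrightarrow> u x = 0" "\<And>x. norm x > R \<Longrightarrow> grad u x = 0"
    "\<And>x. \<bar>u x * (grad u x \<bullet> x)\<bar> \<le> M\<^sup>2 * R"
proof -
  obtain M where M: "M > 0" "\<And>x. \<bar>u x\<bar> \<le> M \<and> norm (grad u x) \<le> M"
    using C1_cc_bound[OF assms] by blast
  obtain R where R: "R > 0" "\<And>x. norm x > R \<Longrightarrow> u x = 0 \<and> grad u x = 0"
    using C1_cc_support[OF assms] by blast
  have "\<bar>u x * (grad u x \<bullet> x)\<bar> \<le> M\<^sup>2 * R" for x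
  proof (cases "norm x \<le> R")
    case True
    have "\<bar>u x\<bar> * \<bar>grad u x \<bullet> x\<bar> \<le> M * (norm (grad u x) * norm x)"
      using M by (intro mult_mono Cauchy_Schwarz_ineq2) auto
    also have "\<dots> \<le> M * (M * R)"
      using M R True by (intro mult_left_mono mult_mono) auto
    finally show ?thesis by (simp add: abs_mult power2_eq_square mult.assoc)
  next
    case False
    then show ?thesis using R M by simp
  qed
  then show thesis using that[of M R] M R by blast
qed

lemma integrable_weight:
  fixes \<psi> :: "'a::euclidean_space \<Rightarrow> real"
  assumes "s < real DIM('a)" "\<psi> \<in> borel_measurable borel"
    and "\<And>x. \<bar>\<psi> x\<bar> \<le> M" "\<And>x. norm x > R \<Longrightarrow> \<psi> x = 0"
  shows "integrable lborel (\<lambda>x. \<psi> x * norm x powr (- s))"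
proof (rule integral_weight_tendsto(1)[where \<phi>="\<lambda>_. \<psi>" and \<delta>="\<lambda>k. inverse (real (Suc k))"])
  show "inverse (real (Suc k)) \<le> 1" for k by (simp add: field_simps)
qed (use assms LIMSEQ_inverse_real_of_nat in auto)

text \<open>The divergence theorem for the field \<open>u\<^sup>2 x / norm x powr s\<close>, obtained as a limit of
  smooth fields.\<close>

lemma weighted_divergence:
  fixes u :: "real^'n \<Rightarrow> real"
  assumes u: "smooth_cc u" and s: "s < real CARD('n)"
  shows "(\<integral>x. (2 * (u x * (grad u x \<bullet> x)) + (real CARD('n) - s) * (u x)\<^sup>2) * norm x powr (- s) \<partial>lborel) = 0"
proof -
  define n where "n = real CARD('n)"
  note u1 = smooth_cc_imp_C1_cc[OF u]
  note [measurable] = C1_cc_borel[OF u1]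
  obtain M R where M: "M > 0" "R > 0" "\<And>x. \<bar>u x\<bar> \<le> M" "\<And>x. norm (grad u x) \<le> M"
    "\<And>x. norm x > R \<Longrightarrow> u x = 0" "\<And>x. norm x > R \<Longrightarrow> grad u x = 0"
    "\<And>x. \<bar>u x * (grad u x \<bullet> x)\<bar> \<le> M\<^sup>2 * R"
    using C1_cc_bounds[OF u1] by blast
  define \<delta> where "\<delta> k = inverse (real (Suc k))" for k
  have \<delta>: "\<delta> \<longlonglongrightarrow> 0" "\<And>k. 0 < \<delta> k" "\<And>k. \<delta> k \<le> 1"
    unfolding \<delta>_def[abs_def] using LIMSEQ_inverse_real_of_nat by (auto simp: field_simps)
  \<comment> \<open>The divergence of the regularised field, divided by its weight. The fraction is
    what differentiating the weight along x leaves behind; it lies in [0, 1] and tends to 1 away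
    from the origin.\<close>
  define \<phi> where "\<phi> k x = 2 * (u x * (grad u x \<bullet> x)) + (n - s * (x \<bullet> x / (\<delta> k + x \<bullet> x))) * (u x)\<^sup>2" for k x
  have frac: "0 \<le> x \<bullet> x / (\<delta> k + x \<bullet> x)" "x \<bullet> x / (\<delta> k + x \<bullet> x) \<le> 1" for x :: "real^'n" and k
    using \<delta>(2)[of k] by (auto simp: divide_le_eq add_pos_nonneg add_nonneg_nonneg intro!: divide_nonneg_nonneg)
  have zero: "(\<integral>x. \<phi> k x * (\<delta> k + x \<bullet> x) powr (- s / 2) \<partial>lborel) = 0" for k
  proof -
    define r where "r = - s / 2"
    define d where "d b x v = (u x)\<^sup>2 * ((x \<bullet> b) * (2 * r * (\<delta> k + x \<bullet> x) powr (r - 1) * (v \<bullet> x)) + (v \<bullet> b) * (\<delta> k + x \<bullet> x) powr r)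
        + (2 * (u x * (grad u x \<bullet> v))) * ((x \<bullet> b) * (\<delta> k + x \<bullet> x) powr r)" for b x v :: "real^'n"
    have d: "((\<lambda>x. (u x)\<^sup>2 * ((x \<bullet> b) * (\<delta> k + x \<bullet> x) powr r)) has_derivative d b x) (at x)" for b x
    proof -
      have 1: "((\<lambda>x. (u x)\<^sup>2) has_derivative (\<lambda>v. 2 * (u x * (grad u x \<bullet> v)))) (at x)"
        by (auto intro!: derivative_eq_intros C1_cc_has_derivative[OF u1] simp: mult_ac)
      have 2: "((\<lambda>x. x \<bullet> b) has_derivative (\<lambda>v. v \<bullet> b)) (at x)"
        by (auto intro!: derivative_eq_intros)
      show ?thesis
        using has_derivative_mult[OF 1 has_derivative_mult[OF 2 weight_has_derivative[OF \<delta>(2)[of k], of r x]]]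
        by (simp add: d_def[abs_def])
    qed
    have c: "C1_cc (\<lambda>x. (u x)\<^sup>2 * ((x \<bullet> b) * (\<delta> k + x \<bullet> x) powr r))" for b
    proof -
      have "smooth_cc (\<lambda>x. u x * (u x * ((b \<bullet> x) * (\<delta> k + x \<bullet> x) powr r)))"
        using u by (intro smooth_cc_mult Ck_mult Ck_inner Ck_weight \<delta>(2)) (auto simp: smooth_cc_def)
      then show ?thesis
        using smooth_cc_imp_C1_cc by (simp add: power2_eq_square mult.assoc inner_commute)
    qed
    \<comment> \<open>Here \<open>d b x b\<close> is the b-th partial derivative of the b-th
      component, so the sum is the divergence. Every summand has integral 0 on its own.\<close>
    have "(\<Sum>b\<in>Basis. d b x b) = \<phi> k x * (\<delta> k + x \<bullet> x) powr (- s / 2)" for x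
    proof -
      define D where "D = \<delta> k + x \<bullet> x"
      have D: "D > 0" using \<delta>(2)[of k] by (simp add: D_def add_pos_nonneg)
      have "(\<Sum>b\<in>Basis. d b x b) = (u x)\<^sup>2 * (2 * r * D powr (r - 1) * (\<Sum>b\<in>Basis. (x \<bullet> b) * (x \<bullet> b)) + (\<Sum>b\<in>(Basis::(real^'n) set). b \<bullet> b) * D powr r)
          + 2 * u x * D powr r * (\<Sum>b\<in>Basis. (grad u x \<bullet> b) * (x \<bullet> b))"
        unfolding d_def D_def[symmetric]
        by (simp add: sum.distrib sum_distrib_left sum_distrib_right algebra_simps inner_commute)
      also have "\<dots> = (u x)\<^sup>2 * (2 * r * D powr (r - 1) * (x \<bullet> x) + n * D powr r) + 2 * u x * D powr r * (grad u x \<bullet> x)"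
        by (simp add: euclidean_inner[symmetric] n_def)
      also have "D powr (r - 1) = D powr r / D" using D by (simp add: powr_diff)
      also have "(u x)\<^sup>2 * (2 * r * (D powr r / D) * (x \<bullet> x) + n * D powr r) + 2 * u x * D powr r * (grad u x \<bullet> x)
          = \<phi> k x * D powr (- s / 2)"
        by (simp add: \<phi>_def D_def[symmetric] r_def algebra_simps)
      finally show ?thesis by (simp add: D_def)
    qed
    then have "(\<integral>x. \<phi> k x * (\<delta> k + x \<bullet> x) powr (- s / 2) \<partial>lborel) = (\<integral>x. (\<Sum>b\<in>Basis. d b x b) \<partial>lborel)"
      by simp
    also have "\<dots> = (\<Sum>b\<in>Basis. \<integral>x. d b x b \<partial>lborel)"
      by (intro Bochner_Integration.integral_sum integral_has_derivative_eq_0(2)[OF c d])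
    also have "\<dots> = 0"
      by (intro sum.neutral ballI integral_has_derivative_eq_0(1)[OF c d])
    finally show ?thesis .
  qed
  have "(\<lambda>k. \<integral>x. \<phi> k x * (\<delta> k + x \<bullet> x) powr (- s / 2) \<partial>lborel)
    \<longlonglongrightarrow> (\<integral>x. (2 * (u x * (grad u x \<bullet> x)) + (n - s) * (u x)\<^sup>2) * norm x powr (- s) \<partial>lborel)"
  proof (rule integral_weight_tendsto(2)[where M="2 * (M\<^sup>2 * R) + (n + \<bar>s\<bar>) * M\<^sup>2" and R=R, OF _ _ _ _ _ _ \<delta>])
    show "\<phi> k \<in> borel_measurable borel" for k unfolding \<phi>_def by measurable
    fix k and x :: "real^'n"
    have "\<bar>n - s * (x \<bullet> x / (\<delta> k + x \<bullet> x))\<bar> \<le> n + \<bar>s\<bar> * 1"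
    proof -
      have "\<bar>s * (x \<bullet> x / (\<delta> k + x \<bullet> x))\<bar> \<le> \<bar>s\<bar> * 1"
        unfolding abs_mult using frac[where x=x and k=k]
        by (intro mult_left_mono) (simp_all only: abs_of_nonneg abs_ge_zero)
      moreover have "n \<ge> 0" by (simp add: n_def)
      ultimately show ?thesis by linarith
    qed
    then have "\<bar>n - s * (x \<bullet> x / (\<delta> k + x \<bullet> x))\<bar> * (u x)\<^sup>2 \<le> (n + \<bar>s\<bar>) * M\<^sup>2"
      using power_mono[OF M(3)[of x], of 2] by (intro mult_mono) (auto simp: power2_abs n_def)
    then show "\<bar>\<phi> k x\<bar> \<le> 2 * (M\<^sup>2 * R) + (n + \<bar>s\<bar>) * M\<^sup>2"
      unfolding \<phi>_def using M(7)[of x]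
      by (intro order_trans[OF abs_triangle_ineq] add_mono) (simp_all add: abs_mult)
    show "\<phi> k x = 0" if "norm x > R" using M(5)[OF that] by (simp add: \<phi>_def)
  next
    fix x :: "real^'n" assume "x \<noteq> 0"
    then have "(\<lambda>k. \<phi> k x) \<longlonglongrightarrow> 2 * (u x * (grad u x \<bullet> x)) + (n - s * (x \<bullet> x / (0 + x \<bullet> x))) * (u x)\<^sup>2"
      unfolding \<phi>_def by (intro tendsto_intros \<delta>) auto
    then show "(\<lambda>k. \<phi> k x) \<longlonglongrightarrow> 2 * (u x * (grad u x \<bullet> x)) + (n - s) * (u x)\<^sup>2"
      using \<open>x \<noteq> 0\<close> by simp
  qed (use s in \<open>simp_all add: n_def\<close>)
  then show ?thesis unfolding zero n_def by (simp add: LIMSEQ_const_iff)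
qed

text \<open>Hoelder's inequality with exponents 1/\<theta> and 1/(1 - \<theta>), written so that the
  endpoints are included. It is Young's inequality for X / I and Y / J, integrated.\<close>

lemma integral_powr_interpolation:
  fixes X Y :: "'a \<Rightarrow> real"
  assumes X: "integrable M X" "\<And>x. X x \<ge> 0" and Y: "integrable M Y" "\<And>x. Y x \<ge> 0"
    and \<theta>: "0 \<le> \<theta>" "\<theta> \<le> 1"
  shows "(\<integral>x. X x powr \<theta> * Y x powr (1 - \<theta>) \<partial>M)
    \<le> (\<integral>x. X x \<partial>M) powr \<theta> * (\<integral>x. Y x \<partial>M) powr (1 - \<theta>)"
proof -
  define I J where "I = (\<integral>x. X x \<partial>M)" and "J = (\<integral>x. Y x \<partial>M)"
  have IJ: "I \<ge> 0" "J \<ge> 0" unfolding I_def J_def using X Y by auto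
  show ?thesis
  proof (cases "I = 0 \<or> J = 0")
    case True
    then have "(AE x in M. X x = 0) \<or> (AE x in M. Y x = 0)"
      unfolding I_def J_def using X Y by (simp add: integral_nonneg_eq_0_iff_AE)
    \<comment> \<open>At the endpoints this relies on the convention
      \<open>0 powr 0 = 0\<close>.\<close>
    then have "AE x in M. X x powr \<theta> * Y x powr (1 - \<theta>) = 0"
      by (auto elim: eventually_mono)
    then have "(\<integral>x. X x powr \<theta> * Y x powr (1 - \<theta>) \<partial>M) = 0"
      by (rule integral_eq_zero_AE)
    then show ?thesis by simp
  next
    case False
    then have I: "I > 0" and J: "J > 0" using IJ by auto
    have "(\<integral>x. X x powr \<theta> * Y x powr (1 - \<theta>) \<partial>M)
        \<le> (\<integral>x. I powr \<theta> * J powr (1 - \<theta>) * (\<theta> * (X x / I) + (1 - \<theta>) * (Y x / J)) \<partial>M)"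
    proof (rule integral_mono')
      fix x
      show nn: "0 \<le> I powr \<theta> * J powr (1 - \<theta>) * (\<theta> * (X x / I) + (1 - \<theta>) * (Y x / J))"
        using X Y \<theta> I J by simp
      show "X x powr \<theta> * Y x powr (1 - \<theta>) \<le> I powr \<theta> * J powr (1 - \<theta>) * (\<theta> * (X x / I) + (1 - \<theta>) * (Y x / J))"
      proof (cases "X x = 0 \<or> Y x = 0")
        case True
        then show ?thesis using nn by auto
      next
        case False
        then have "X x > 0" "Y x > 0" using X(2)[of x] Y(2)[of x] by auto
        then have "(X x / I) powr \<theta> * (Y x / J) powr (1 - \<theta>) \<le> \<theta> * (X x / I) + (1 - \<theta>) * (Y x / J)"
          using I J \<theta> by (intro Youngs_inequality_0) auto
        then show ?thesis
          using I J X(2)[of x] Y(2)[of x] by (simp add: powr_divide divide_le_eq mult_ac)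
      qed
    qed (use X Y in auto)
    also have "\<dots> = I powr \<theta> * J powr (1 - \<theta>) * (\<theta> * (I / I) + (1 - \<theta>) * (J / J))"
      using X Y by (simp add: I_def J_def)
    also have "\<dots> = I powr \<theta> * J powr (1 - \<theta>)" using I J by simp
    finally show ?thesis by (simp add: I_def J_def)
  qed
qed

section \<open>The two endpoint inequalities for a fixed test function\<close>

context
  fixes u :: "real^'n \<Rightarrow> real" and a n m A H I :: real
  assumes n3: "CARD('n) \<ge> 3" and u: "smooth_cc u"
    and a: "a < (real CARD('n) - 2) / 2"
  defines "n \<equiv> real CARD('n)" and "m \<equiv> real CARD('n) - 2 - 2 * a"
    and "A \<equiv> (\<integral>x. (norm (grad u x))\<^sup>2 * norm x powr (- (2 * a)) \<partial>lborel)"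
    and "H \<equiv> (\<integral>x. (u x)\<^sup>2 * norm x powr (- (2 * a + 2)) \<partial>lborel)"
    and "I \<equiv> (\<integral>x. \<bar>u x\<bar> powr (2 * n / (n - 2)) * norm x powr (- (2 * a * n / (n - 2))) \<partial>lborel)"
begin

lemma dim_ge_3: "n \<ge> 3" using n3 by (simp add: n_def)
lemma weight_gap_eq: "m = n - 2 - 2 * a" by (simp add: m_def n_def)
lemma weight_gap_pos: "m > 0" using a by (simp add: m_def)

text \<open>Every singular exponent stays below n because m > 0: 2a + 2 < n is the same condition as
  m > 0, and so is 2an / (n - 2) < n.\<close>

lemma weight_integrable:
  shows "integrable lborel (\<lambda>x. (norm (grad u x))\<^sup>2 * norm x powr (- (2 * a)))"
    and "integrable lborel (\<lambda>x. (u x)\<^sup>2 * norm x powr (- (2 * a + 2)))"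
    and "integrable lborel (\<lambda>x. (u x * (grad u x \<bullet> x)) * norm x powr (- (2 * a + 2)))"
    and "integrable lborel (\<lambda>x. \<bar>u x\<bar> powr (2 * n / (n - 2)) * norm x powr (- (2 * a * n / (n - 2))))"
proof -
  note u1 = smooth_cc_imp_C1_cc[OF u]
  note [measurable] = C1_cc_borel[OF u1]
  obtain M R where M: "M > 0" "R > 0" "\<And>x. \<bar>u x\<bar> \<le> M" "\<And>x. norm (grad u x) \<le> M"
    "\<And>x. norm x > R \<Longrightarrow> u x = 0" "\<And>x. norm x > R \<Longrightarrow> grad u x = 0"
    "\<And>x. \<bar>u x * (grad u x \<bullet> x)\<bar> \<le> M\<^sup>2 * R"
    using C1_cc_bounds[OF u1] by blast
  have s: "2 * a < real DIM(real^'n)" "2 * a + 2 < real DIM(real^'n)" "2 * a * n / (n - 2) < real DIM(real^'n)"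
    using weight_gap_pos dim_ge_3 by (simp_all add: m_def n_def[symmetric] divide_less_eq mult.commute)
  have u2: "(u x)\<^sup>2 \<le> M\<^sup>2" for x
    using power_mono[OF M(3)[of x], of 2] by simp
  show "integrable lborel (\<lambda>x. (norm (grad u x))\<^sup>2 * norm x powr (- (2 * a)))"
    by (rule integrable_weight[where M="M\<^sup>2" and R=R, OF s(1)])
       (use M power_mono[OF M(4), of 2] in auto)
  show "integrable lborel (\<lambda>x. (u x)\<^sup>2 * norm x powr (- (2 * a + 2)))"
    by (rule integrable_weight[where M="M\<^sup>2" and R=R, OF s(2)]) (use M u2 in auto)
  show "integrable lborel (\<lambda>x. (u x * (grad u x \<bullet> x)) * norm x powr (- (2 * a + 2)))"
    by (rule integrable_weight[where M="M\<^sup>2 * R" and R=R, OF s(2)]) (use M in auto)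
  show "integrable lborel (\<lambda>x. \<bar>u x\<bar> powr (2 * n / (n - 2)) * norm x powr (- (2 * a * n / (n - 2))))"
    by (rule integrable_weight[where M="M powr (2 * n / (n - 2))" and R=R, OF s(3)])
       (use M dim_ge_3 in \<open>auto intro!: powr_mono2\<close>)
qed

lemma weighted_nonneg: "A \<ge> 0" "H \<ge> 0" "I \<ge> 0"
  by (simp_all add: A_def H_def I_def)

text \<open>The divergence identity at s = 2a + 2, where n - s = m. It drives both endpoints: Hardy
  estimates the cross term, and the Sobolev energy is evaluated with it.\<close>

lemma weighted_cross_term:
  "2 * (\<integral>x. (u x * (grad u x \<bullet> x)) * norm x powr (- (2 * a + 2)) \<partial>lborel) = - m * H"
proof -
  have "2 * a + 2 < real CARD('n)" using weight_gap_pos by (simp add: m_def)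
  from weighted_divergence[OF u this]
  have "0 = (\<integral>x. 2 * ((u x * (grad u x \<bullet> x)) * norm x powr (- (2 * a + 2)))
      + m * ((u x)\<^sup>2 * norm x powr (- (2 * a + 2))) \<partial>lborel)"
    by (simp add: m_def algebra_simps)
  also have "\<dots> = 2 * (\<integral>x. (u x * (grad u x \<bullet> x)) * norm x powr (- (2 * a + 2)) \<partial>lborel) + m * H"
    unfolding H_def using weight_integrable by simp
  finally show ?thesis by simp
qed

text \<open>Young's inequality splits the cross term with coefficients m / 2 and 2 / m. Exactly half
  of m H is absorbed, and the remaining m / 2 * H <= 2 / m * A gives the constant.\<close>

lemma weighted_Hardy: "H \<le> 4 / m\<^sup>2 * A"
proof -
  have "- m * H = (\<integral>x. 2 * ((u x * (grad u x \<bullet> x)) * norm x powr (- (2 * a + 2))) \<partial>lborel)"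
    using weighted_cross_term by simp
  also have "\<dots> \<ge> (\<integral>x. - (m / 2) * ((u x)\<^sup>2 * norm x powr (- (2 * a + 2)))
      - 2 / m * ((norm (grad u x))\<^sup>2 * norm x powr (- (2 * a))) \<partial>lborel)"
  proof (rule integral_mono)
    fix x
    show "- (m / 2) * ((u x)\<^sup>2 * norm x powr (- (2 * a + 2))) - 2 / m * ((norm (grad u x))\<^sup>2 * norm x powr (- (2 * a)))
        \<le> 2 * ((u x * (grad u x \<bullet> x)) * norm x powr (- (2 * a + 2)))"
    proof (cases "x = 0")
      case False
      have w: "norm x powr (- (2 * a)) = (norm x)\<^sup>2 * norm x powr (- (2 * a + 2))"
        using False by (simp add: powr_add[symmetric] flip: powr_numeral)
      have "\<bar>u x * (grad u x \<bullet> x)\<bar> \<le> \<bar>u x\<bar> * (norm (grad u x) * norm x)"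
        unfolding abs_mult by (intro mult_left_mono Cauchy_Schwarz_ineq2) auto
      moreover have "2 * (\<bar>u x\<bar> * (norm (grad u x) * norm x)) \<le> m / 2 * (u x)\<^sup>2 + 2 / m * ((norm (grad u x))\<^sup>2 * (norm x)\<^sup>2)"
      proof -
        have "0 \<le> (m * \<bar>u x\<bar> - 2 * (norm (grad u x) * norm x))\<^sup>2 / (2 * m)"
          using weight_gap_pos by simp
        also have "\<dots> = m / 2 * (u x)\<^sup>2 + 2 / m * ((norm (grad u x))\<^sup>2 * (norm x)\<^sup>2) - 2 * (\<bar>u x\<bar> * (norm (grad u x) * norm x))"
          using weight_gap_pos by (simp add: power2_diff power_mult_distrib field_simps) (simp add: power2_eq_square algebra_simps)
        finally show ?thesis by simp
      qed
      ultimately have "- (m / 2) * (u x)\<^sup>2 - 2 / m * ((norm (grad u x))\<^sup>2 * (norm x)\<^sup>2) \<le> 2 * (u x * (grad u x \<bullet> x))"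
        by linarith
      then have "(- (m / 2) * (u x)\<^sup>2 - 2 / m * ((norm (grad u x))\<^sup>2 * (norm x)\<^sup>2)) * norm x powr (- (2 * a + 2))
          \<le> 2 * (u x * (grad u x \<bullet> x)) * norm x powr (- (2 * a + 2))"
        by (rule mult_right_mono) simp
      then show ?thesis unfolding w by (simp add: algebra_simps)
    qed simp
  qed (use weight_integrable in auto)
  also have "(\<integral>x. - (m / 2) * ((u x)\<^sup>2 * norm x powr (- (2 * a + 2)))
      - 2 / m * ((norm (grad u x))\<^sup>2 * norm x powr (- (2 * a))) \<partial>lborel) = - (m / 2) * H - 2 / m * A"
    unfolding H_def A_def using weight_integrable
    by (subst Bochner_Integration.integral_diff) simp_all
  finally have "m / 2 * H \<le> 2 / m * A" by simp
  then show ?thesis using weight_gap_pos by (simp add: power2_eq_square field_simps)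
qed

text \<open>The Sobolev inequality for \<open>u / norm x powr a\<close>, approximated by the test functions
  \<open>u * (\<delta> + x \<bullet> x) powr (- a / 2)\<close>.\<close>

lemma weighted_Sobolev_aux:
  "I powr ((n - 2) / (2 * n)) \<le> sobolev_K TYPE('n) * (A + a * (n - 2 - a) * H) powr (1 / 2)"
  and weighted_energy_nonneg: "0 \<le> A + a * (n - 2 - a) * H"
proof -
  note u1 = smooth_cc_imp_C1_cc[OF u]
  note [measurable] = C1_cc_borel[OF u1]
  obtain M R where M: "M > 0" "R > 0" "\<And>x. \<bar>u x\<bar> \<le> M" "\<And>x. norm (grad u x) \<le> M"
    "\<And>x. norm x > R \<Longrightarrow> u x = 0" "\<And>x. norm x > R \<Longrightarrow> grad u x = 0"
    "\<And>x. \<bar>u x * (grad u x \<bullet> x)\<bar> \<le> M\<^sup>2 * R"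
    using C1_cc_bounds[OF u1] by blast
  define q where "q = 2 * n / (n - 2)"
  have q: "q > 0" using dim_ge_3 by (simp add: q_def)
  define \<delta> where "\<delta> k = inverse (real (Suc k))" for k
  have \<delta>: "\<delta> \<longlonglongrightarrow> 0" "\<And>k. 0 < \<delta> k" "\<And>k. \<delta> k \<le> 1"
    unfolding \<delta>_def[abs_def] using LIMSEQ_inverse_real_of_nat by (auto simp: field_simps)
  have D: "\<delta> k + x \<bullet> x > 0" for k and x :: "real^'n"
    using \<delta>(2)[of k] by (simp add: add_pos_nonneg)
  define v where "v k x = u x * (\<delta> k + x \<bullet> x) powr (- a / 2)" for k x
  have v: "smooth_cc (v k)" for k
    unfolding v_def[abs_def] by (intro smooth_cc_mult u Ck_weight \<delta>(2))
  \<comment> \<open>The expanded square of the gradient of \<open>v k\<close>, with the weight of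
    exponent - (2a + 2) / 2 taken out of all three terms. The common exponent s = 2a + 2 is the one
    occurring in \<open>H\<close> and in the cross term; \<psi> is the pointwise limit away from the
    origin.\<close>
  define \<phi> where "\<phi> k x = (norm (grad u x))\<^sup>2 * (\<delta> k + x \<bullet> x) - 2 * a * (u x * (grad u x \<bullet> x))
      + a\<^sup>2 * (u x)\<^sup>2 * (x \<bullet> x / (\<delta> k + x \<bullet> x))" for k x
  define \<psi> where "\<psi> x = (norm (grad u x))\<^sup>2 * (norm x)\<^sup>2 - 2 * a * (u x * (grad u x \<bullet> x)) + a\<^sup>2 * (u x)\<^sup>2" for x
  have grad_v: "(norm (grad (v k) x))\<^sup>2 = \<phi> k x * (\<delta> k + x \<bullet> x) powr (- (2 * a + 2) / 2)" for k x
  proof -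
    define D w where "D = \<delta> k + x \<bullet> x" and "w = D powr (- a / 2)"
    have D': "D > 0" using D by (simp add: D_def)
    have "(v k has_derivative (\<lambda>h. (w *\<^sub>R (grad u x - (a * u x / D) *\<^sub>R x)) \<bullet> h)) (at x)"
    proof -
      have "D powr (- (a / 2) - 1) = w / D" using D' by (simp add: w_def powr_diff)
      then show ?thesis
        using has_derivative_mult[OF C1_cc_has_derivative[OF u1] weight_has_derivative[OF \<delta>(2)[of k], of "- a / 2" x]]
        unfolding v_def[abs_def] D_def[symmetric] w_def[symmetric]
        by (elim has_derivative_eq_rhs)
           (simp add: fun_eq_iff inner_diff_left algebra_simps inner_commute flip: times_divide_eq_right,
            use D' in \<open>simp add: field_simps\<close>)
    qed
    then have eq: "grad (v k) x = w *\<^sub>R (grad u x - (a * u x / D) *\<^sub>R x)"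
      by (rule grad_unique)
    have "(norm (grad (v k) x))\<^sup>2 = w\<^sup>2 * ((norm (grad u x))\<^sup>2 - 2 * (a * u x / D) * (grad u x \<bullet> x) + (a * u x / D)\<^sup>2 * (x \<bullet> x))"
      unfolding eq power2_norm_eq_inner
      by (simp add: inner_diff_left inner_diff_right inner_commute power2_eq_square algebra_simps)
    also have "w\<^sup>2 = D * D powr (- (2 * a + 2) / 2)"
    proof -
      have "w\<^sup>2 = D powr (- a)" using D' by (simp add: w_def powr_powr flip: powr_numeral)
      also have "- a = 1 + (- (2 * a + 2) / 2)" by (simp add: field_simps)
      also have "D powr (1 + (- (2 * a + 2) / 2)) = D * D powr (- (2 * a + 2) / 2)"
        using D' by (subst powr_add) simp
      finally show ?thesis .
    qed
    also have "D * D powr (- (2 * a + 2) / 2) * ((norm (grad u x))\<^sup>2 - 2 * (a * u x / D) * (grad u x \<bullet> x) + (a * u x / D)\<^sup>2 * (x \<bullet> x))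
        = (D * ((norm (grad u x))\<^sup>2 - 2 * (a * u x / D) * (grad u x \<bullet> x) + (a * u x / D)\<^sup>2 * (x \<bullet> x))) * D powr (- (2 * a + 2) / 2)"
      by simp
    also have "D * ((norm (grad u x))\<^sup>2 - 2 * (a * u x / D) * (grad u x \<bullet> x) + (a * u x / D)\<^sup>2 * (x \<bullet> x)) = \<phi> k x"
      unfolding \<phi>_def D_def[symmetric] using D' by (simp add: power2_eq_square field_simps)
    finally show ?thesis by (simp add: D_def)
  qed
  have lim_rhs: "(\<lambda>k. \<integral>x. (norm (grad (v k) x))\<^sup>2 \<partial>lborel) \<longlonglongrightarrow> (\<integral>x. \<psi> x * norm x powr (- (2 * a + 2)) \<partial>lborel)"
    unfolding grad_v
  proof (rule integral_weight_tendsto(2)[where M="M\<^sup>2 * (1 + R\<^sup>2) + 2 * \<bar>a\<bar> * (M\<^sup>2 * R) + a\<^sup>2 * M\<^sup>2" and R=R, OF _ _ _ _ _ _ \<delta>])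
    show "2 * a + 2 < real DIM(real^'n)" using weight_gap_pos by (simp add: m_def)
    show "\<phi> k \<in> borel_measurable borel" for k unfolding \<phi>_def by measurable
    show "\<psi> \<in> borel_measurable borel" unfolding \<psi>_def by measurable
    show \<phi>0: "\<phi> k x = 0" if "norm x > R" for k x
      using M(5,6)[OF that] by (simp add: \<phi>_def)
    show "\<bar>\<phi> k x\<bar> \<le> M\<^sup>2 * (1 + R\<^sup>2) + 2 * \<bar>a\<bar> * (M\<^sup>2 * R) + a\<^sup>2 * M\<^sup>2" for k x
    proof (cases "norm x \<le> R")
      case True
      have "(norm (grad u x))\<^sup>2 * (\<delta> k + x \<bullet> x) \<le> M\<^sup>2 * (1 + R\<^sup>2)"
        using M(4)[of x] True \<delta>(3)[of k] D[of k x]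
        by (intro mult_mono add_mono power_mono) (auto simp: dot_square_norm intro!: power_mono)
      moreover have "\<bar>2 * a * (u x * (grad u x \<bullet> x))\<bar> \<le> 2 * \<bar>a\<bar> * (M\<^sup>2 * R)"
        using mult_left_mono[OF M(7)[of x], of "2 * \<bar>a\<bar>"] by (simp add: abs_mult)
      moreover have "a\<^sup>2 * (u x)\<^sup>2 * (x \<bullet> x / (\<delta> k + x \<bullet> x)) \<le> a\<^sup>2 * M\<^sup>2 * 1"
        using power_mono[OF M(3)[of x], of 2] D[of k x] \<delta>(2)[of k] by (intro mult_mono) auto
      moreover have "0 \<le> (norm (grad u x))\<^sup>2 * (\<delta> k + x \<bullet> x)" "0 \<le> a\<^sup>2 * (u x)\<^sup>2 * (x \<bullet> x / (\<delta> k + x \<bullet> x))"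
        using D[of k x] by simp_all
      ultimately show ?thesis unfolding \<phi>_def by linarith
    next
      case False
      then show ?thesis using \<phi>0[of x k] M(1,2) by simp
    qed
    show "(\<lambda>k. \<phi> k x) \<longlonglongrightarrow> \<psi> x" if "x \<noteq> 0" for x
    proof -
      have "(\<lambda>k. \<phi> k x) \<longlonglongrightarrow> (norm (grad u x))\<^sup>2 * (0 + x \<bullet> x) - 2 * a * (u x * (grad u x \<bullet> x))
          + a\<^sup>2 * (u x)\<^sup>2 * (x \<bullet> x / (0 + x \<bullet> x))"
        unfolding \<phi>_def using that by (intro tendsto_intros \<delta>) auto
      then show ?thesis using that by (simp add: \<psi>_def dot_square_norm)
    qed
  qed
  have \<psi>_int: "(\<integral>x. \<psi> x * norm x powr (- (2 * a + 2)) \<partial>lborel) = A + a * (n - 2 - a) * H"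
  proof -
    have "\<psi> x * norm x powr (- (2 * a + 2)) = (norm (grad u x))\<^sup>2 * norm x powr (- (2 * a))
        - 2 * a * ((u x * (grad u x \<bullet> x)) * norm x powr (- (2 * a + 2)))
        + a\<^sup>2 * ((u x)\<^sup>2 * norm x powr (- (2 * a + 2)))" for x
    proof (cases "x = 0")
      case False
      have w: "norm x powr (- (2 * a)) = (norm x)\<^sup>2 * norm x powr (- (2 * a + 2))"
        using False by (simp add: powr_add[symmetric] flip: powr_numeral)
      show ?thesis unfolding \<psi>_def w by (simp add: algebra_simps)
    qed simp
    then have "(\<integral>x. \<psi> x * norm x powr (- (2 * a + 2)) \<partial>lborel)
        = A - a * (2 * (\<integral>x. (u x * (grad u x \<bullet> x)) * norm x powr (- (2 * a + 2)) \<partial>lborel)) + a\<^sup>2 * H"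
      unfolding A_def H_def using weight_integrable by simp
    also have "\<dots> = A + a * (n - 2 - a) * H"
      unfolding weighted_cross_term weight_gap_eq by (simp add: power2_eq_square algebra_simps)
    finally show ?thesis .
  qed
  have "(\<lambda>k. \<integral>x. \<bar>v k x\<bar> powr q \<partial>lborel) \<longlonglongrightarrow> I"
  proof -
    have eq: "\<bar>v k x\<bar> powr q = \<bar>u x\<bar> powr q * (\<delta> k + x \<bullet> x) powr (- (2 * a * n / (n - 2)) / 2)" for k x
    proof -
      have 1: "\<bar>v k x\<bar> = \<bar>u x\<bar> * (\<delta> k + x \<bullet> x) powr (- a / 2)"
        by (simp add: v_def abs_mult)
      have 2: "- a / 2 * q = - (2 * a * n / (n - 2)) / 2"
        using dim_ge_3 by (simp add: q_def field_simps)
      show ?thesis unfolding 1 powr_mult powr_powr 2 ..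
    qed
    show ?thesis
      unfolding eq I_def q_def[symmetric]
    proof (rule integral_weight_tendsto(2)[where M="M powr q" and R=R, OF _ _ _ _ _ _ \<delta>])
      show "2 * a * n / (n - 2) < real DIM(real^'n)"
        using weight_gap_pos dim_ge_3 by (simp add: m_def n_def[symmetric] divide_less_eq mult.commute)
      show "\<bar>\<bar>u x\<bar> powr q\<bar> \<le> M powr q" for x using M q by (auto intro!: powr_mono2)
    qed (use M in auto)
  qed
  then have "(\<lambda>k. (\<integral>x. \<bar>v k x\<bar> powr q \<partial>lborel) powr ((n - 2) / (2 * n))) \<longlonglongrightarrow> I powr ((n - 2) / (2 * n))"
    using dim_ge_3 by (intro tendsto_powr' tendsto_const) auto
  moreover have "(\<lambda>k. sobolev_K TYPE('n) * (\<integral>x. (norm (grad (v k) x))\<^sup>2 \<partial>lborel) powr (1/2))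
      \<longlonglongrightarrow> sobolev_K TYPE('n) * (A + a * (n - 2 - a) * H) powr (1/2)"
    using lim_rhs unfolding \<psi>_int by (intro tendsto_mult tendsto_powr' tendsto_const) auto
  moreover have "(\<integral>x. \<bar>v k x\<bar> powr q \<partial>lborel) powr ((n - 2) / (2 * n))
      \<le> sobolev_K TYPE('n) * (\<integral>x. (norm (grad (v k) x))\<^sup>2 \<partial>lborel) powr (1/2)" for k
    using sobolev_K_inequality(1)[OF n3 v[of k]] by (simp add: q_def n_def)
  ultimately show "I powr ((n - 2) / (2 * n)) \<le> sobolev_K TYPE('n) * (A + a * (n - 2 - a) * H) powr (1 / 2)"
    by (intro LIMSEQ_le) auto
  \<comment> \<open>A limit of Dirichlet energies. The sign is what allows the square root of this
    energy to be squared back later.\<close>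
  show "0 \<le> A + a * (n - 2 - a) * H"
    by (rule LIMSEQ_le_const[OF lim_rhs[unfolded \<psi>_int]]) simp
qed

text \<open>For a >= 0 the coefficient of \<open>H\<close> is non-negative and Hardy applies; m^2 +
  4a(n - 2 - a) = (n - 2)^2 collapses the result to the stated constant. For a < 0 the coefficient
  is non-positive, so the energy is at most \<open>A\<close>, and n - 2 - 4a >= m makes the stated
  factor at least 1.\<close>

lemma weighted_Sobolev:
  "I powr ((n - 2) / n)
    \<le> (if a \<ge> 0 then (sobolev_K TYPE('n))\<^sup>2 * ((n - 2) / m)\<^sup>2
       else (sobolev_K TYPE('n))\<^sup>2 * ((n - 2 - 4 * a) / m)\<^sup>2) * A"
proof -
  define K where "K = sobolev_K TYPE('n)"
  define E where "E = A + a * (n - 2 - a) * H"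
  have K: "K \<ge> 0" unfolding K_def by (rule sobolev_K_inequality(2)[OF n3 u])
  have IE: "I powr ((n - 2) / n) \<le> K\<^sup>2 * E"
  proof -
    have "I powr ((n - 2) / n) = (I powr ((n - 2) / (2 * n)))\<^sup>2"
    proof -
      have "(n - 2) / n = (n - 2) / (2 * n) + (n - 2) / (2 * n)"
        using dim_ge_3 by (simp add: field_simps)
      then show ?thesis by (simp only: power2_eq_square powr_add)
    qed
    also have "\<dots> \<le> (K * E powr (1 / 2))\<^sup>2"
      using weighted_Sobolev_aux unfolding K_def E_def by (intro power_mono) auto
    also have "\<dots> = K\<^sup>2 * E"
      using weighted_energy_nonneg by (simp add: E_def power_mult_distrib powr_half_sqrt)
    finally show ?thesis .
  qed
  have "E \<le> (if a \<ge> 0 then ((n - 2) / m)\<^sup>2 else ((n - 2 - 4 * a) / m)\<^sup>2) * A"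
  proof (cases "a \<ge> 0")
    case True
    have "n - 2 - a \<ge> 0" using True weight_gap_pos weight_gap_eq by linarith
    then have "E \<le> A + a * (n - 2 - a) * (4 / m\<^sup>2 * A)"
      unfolding E_def using True weighted_Hardy by (intro add_left_mono mult_left_mono) auto
    also have "\<dots> = (m\<^sup>2 + 4 * a * (n - 2 - a)) / m\<^sup>2 * A"
      using weight_gap_pos by (simp add: field_simps)
    also have "m\<^sup>2 + 4 * a * (n - 2 - a) = (n - 2)\<^sup>2"
      unfolding weight_gap_eq by (simp add: power2_eq_square algebra_simps)
    finally show ?thesis using True by (simp add: power_divide)
  next
    case False
    have "n - 2 - a \<ge> 0" using False dim_ge_3 by linarith
    then have "a * (n - 2 - a) * H \<le> 0"
      using False weighted_nonneg by (intro mult_nonpos_nonneg) (auto simp: mult_le_0_iff)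
    then have "E \<le> 1 * A" by (simp add: E_def)
    also have "\<dots> \<le> ((n - 2 - 4 * a) / m)\<^sup>2 * A"
    proof (rule mult_right_mono)
      have "1 \<le> (n - 2 - 4 * a) / m" using False weight_gap_pos weight_gap_eq by (simp add: le_divide_eq)
      then show "1 \<le> ((n - 2 - 4 * a) / m)\<^sup>2" by (rule one_le_power)
    qed (rule weighted_nonneg)
    finally show ?thesis using False by simp
  qed
  then have "K\<^sup>2 * E \<le> K\<^sup>2 * ((if a \<ge> 0 then ((n - 2) / m)\<^sup>2 else ((n - 2 - 4 * a) / m)\<^sup>2) * A)"
    by (rule mult_left_mono) simp
  with IE show ?thesis by (simp add: K_def mult.assoc split: if_splits)
qed

end

theorem theorem3p3:
  fixes u :: "real^'n \<Rightarrow> real" and a b p \<theta> :: real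
  assumes n3: "CARD('n) \<ge> 3"
    and ha: "a < (real CARD('n) - 2) / 2"
    and hab: "a \<le> b" "b \<le> a + 1"
    and hp: "p = 2 * real CARD('n) / (real CARD('n) - 2 + 2 * (b - a))"
    and hu: "smooth_cc u"
    and h\<theta>: "0 \<le> \<theta>" "\<theta> \<le> 1"
    and h\<theta>p: "p = 2 * (1 - \<theta>) + 2 * real CARD('n) / (real CARD('n) - 2) * \<theta>"
  shows "(\<integral>x. \<bar>u x\<bar> powr p / norm x powr (b * p) \<partial>lborel) powr (2 / p)
    \<le> (if a \<ge> 0
        then (sobolev_K TYPE('n))\<^sup>2 * ((real CARD('n) - 2) / (real CARD('n) - 2 - 2 * a))\<^sup>2
        else (sobolev_K TYPE('n))\<^sup>2 * ((real CARD('n) - 2 - 4 * a) / (real CARD('n) - 2 - 2 * a))\<^sup>2)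
       powr (2 * real CARD('n) * \<theta> / ((real CARD('n) - 2) * p))
      * (4 / (real CARD('n) - 2 - 2 * a)\<^sup>2) powr (2 * (1 - \<theta>) / p)
      * (\<integral>x. (norm (grad u x))\<^sup>2 / norm x powr (2 * a) \<partial>lborel)"
proof -
  define n where "n = real CARD('n)"
  define m where "m = n - 2 - 2 * a"
  define q where "q = n / (n - 2)"
  define C where "C = (if a \<ge> 0 then (sobolev_K TYPE('n))\<^sup>2 * ((n - 2) / m)\<^sup>2
    else (sobolev_K TYPE('n))\<^sup>2 * ((n - 2 - 4 * a) / m)\<^sup>2)"
  define A where "A = (\<integral>x. (norm (grad u x))\<^sup>2 * norm x powr (- (2 * a)) \<partial>lborel)"
  define H where "H = (\<integral>x. (u x)\<^sup>2 * norm x powr (- (2 * a + 2)) \<partial>lborel)"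
  define I where "I = (\<integral>x. \<bar>u x\<bar> powr (2 * n / (n - 2)) * norm x powr (- (2 * a * n / (n - 2))) \<partial>lborel)"
  define T where "T = (\<integral>x. \<bar>u x\<bar> powr p / norm x powr (b * p) \<partial>lborel)"
  have n: "n \<ge> 3" using n3 by (simp add: n_def)
  have q: "q > 1" using n by (simp add: q_def)
  have m: "m > 0" using ha by (simp add: m_def n_def)
  have nonneg: "A \<ge> 0" "H \<ge> 0" "I \<ge> 0" "T \<ge> 0" "C \<ge> 0"
    by (simp_all add: A_def H_def I_def T_def C_def)
  have Hardy: "H \<le> 4 / m\<^sup>2 * A"
    using weighted_Hardy[OF n3 hu ha] by (simp add: H_def A_def m_def n_def)
  have Sobolev: "I powr (1 / q) \<le> C * A"
    using weighted_Sobolev[OF n3 hu ha]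
    by (cases "a \<ge> 0") (simp_all add: I_def A_def C_def m_def n_def q_def)
  have p: "p = 2 * (1 - \<theta>) + 2 * q * \<theta>" using h\<theta>p by (simp add: q_def n_def)
  have p2: "p \<ge> 2"
  proof -
    have "q * \<theta> \<ge> 1 * \<theta>" using q h\<theta> by (intro mult_right_mono) auto
    then show ?thesis using p by simp
  qed
  \<comment> \<open>Equating the two expressions for p gives p (b - a) = 2 (1 - \<theta>). Hence b p
    interpolates linearly between the exponents of the two endpoint weights, just as p does between
    the powers of u.\<close>
  have bp: "b * p = (1 - \<theta>) * (2 * a + 2) + \<theta> * (2 * q * a)"
  proof -
    have "n - 2 + 2 * (b - a) > 0" using n hab by (intro add_pos_nonneg) auto
    then have "p * (n - 2) + 2 * (p * (b - a)) = 2 * n"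
      using hp by (simp add: n_def field_simps)
    moreover have "p * (n - 2) = 2 * (1 - \<theta>) * (n - 2) + 2 * n * \<theta>"
      using n by (simp add: p q_def field_simps)
    ultimately have "p * (b - a) = 2 * (1 - \<theta>)" by (simp add: algebra_simps)
    then have "b * p = a * p + 2 * (1 - \<theta>)" by (simp add: algebra_simps)
    then show ?thesis unfolding p by (simp add: algebra_simps)
  qed
  define X where "X x = \<bar>u x\<bar> powr (2 * n / (n - 2)) * norm x powr (- (2 * a * n / (n - 2)))" for x
  define Y where "Y x = (u x)\<^sup>2 * norm x powr (- (2 * a + 2))" for x
  have XY: "\<bar>u x\<bar> powr p / norm x powr (b * p) = X x powr \<theta> * Y x powr (1 - \<theta>)" for x
  proof (cases "x = 0 \<or> u x = 0")
    \<comment> \<open>Both sides are 0, by \<open>0 powr y = 0\<close> and division by 0; this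
      includes \<theta> = 0 and \<theta> = 1.\<close>
    case True
    then show ?thesis using p2 by (auto simp: X_def Y_def)
  next
    case False
    have "X x = \<bar>u x\<bar> powr (2 * q) * norm x powr (- (2 * q * a))"
      by (simp add: X_def q_def mult_ac)
    moreover have "Y x = \<bar>u x\<bar> powr 2 * norm x powr (- (2 * a + 2))"
      using False by (simp add: Y_def)
    ultimately have "X x powr \<theta> * Y x powr (1 - \<theta>)
        = (\<bar>u x\<bar> powr (2 * q * \<theta>) * \<bar>u x\<bar> powr (2 * (1 - \<theta>)))
          * (norm x powr (- (2 * q * a) * \<theta>) * norm x powr (- (2 * a + 2) * (1 - \<theta>)))"
      by (simp only: powr_mult powr_powr) (simp only: mult_ac)
    also have "\<dots> = \<bar>u x\<bar> powr p * norm x powr (- (b * p))"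
    proof -
      have 1: "2 * q * \<theta> + 2 * (1 - \<theta>) = p" using p by simp
      have 2: "- (2 * q * a) * \<theta> + - (2 * a + 2) * (1 - \<theta>) = - (b * p)"
        unfolding bp by (simp add: algebra_simps)
      show ?thesis unfolding powr_add[symmetric] 1 2 ..
    qed
    finally show ?thesis by (simp add: powr_minus_divide)
  qed
  have T_le: "T \<le> I powr \<theta> * H powr (1 - \<theta>)"
    using integral_powr_interpolation[of lborel X Y \<theta>] weight_integrable(2,4)[OF n3 hu ha] h\<theta>
    unfolding T_def XY I_def H_def X_def[symmetric] Y_def[symmetric]
    by (simp add: X_def[abs_def] Y_def[abs_def] n_def)
  have "T powr (2 / p) \<le> C powr (2 * q * \<theta> / p) * (4 / m\<^sup>2) powr (2 * (1 - \<theta>) / p) * A"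
  proof (cases "I = 0")
    case True
    then have "T = 0" using T_le nonneg(4) by simp
    then show ?thesis using nonneg by simp
  next
    case False
    then have "I powr (1 / q) > 0" by simp
    then have "A \<noteq> 0" using Sobolev by auto
    then have A: "A > 0" using nonneg(1) by simp
    have "T powr (2 / p) \<le> (I powr \<theta> * H powr (1 - \<theta>)) powr (2 / p)"
      using T_le nonneg p2 by (intro powr_mono2) auto
    also have "\<dots> = (I powr (1 / q)) powr (2 * q * \<theta> / p) * H powr (2 * (1 - \<theta>) / p)"
      using q by (simp add: powr_mult powr_powr mult_ac)
    also have "\<dots> \<le> (C * A) powr (2 * q * \<theta> / p) * (4 / m\<^sup>2 * A) powr (2 * (1 - \<theta>) / p)"
      using Sobolev Hardy nonneg q p2 h\<theta> by (intro mult_mono powr_mono2) auto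
    also have "\<dots> = C powr (2 * q * \<theta> / p) * (4 / m\<^sup>2) powr (2 * (1 - \<theta>) / p)
        * (A powr (2 * q * \<theta> / p) * A powr (2 * (1 - \<theta>) / p))"
      by (simp only: powr_mult mult_ac)
    also have "A powr (2 * q * \<theta> / p) * A powr (2 * (1 - \<theta>) / p) = A powr (2 * q * \<theta> / p + 2 * (1 - \<theta>) / p)"
      by (rule powr_add[symmetric])
    \<comment> \<open>The choice of \<theta> makes the two exponents add up to 1, so that
      \<open>A\<close> enters to the first power.\<close>
    also have "2 * q * \<theta> / p + 2 * (1 - \<theta>) / p = 1"
      using p p2 by (simp add: add_divide_distrib[symmetric])
    finally show ?thesis using A by simp
  qed
  moreover have "2 * q * \<theta> / p = 2 * n * \<theta> / ((n - 2) * p)"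
    by (simp add: q_def)
  moreover have "A = (\<integral>x. (norm (grad u x))\<^sup>2 / norm x powr (2 * a) \<partial>lborel)"
    by (simp add: A_def powr_minus_divide)
  ultimately show ?thesis
    unfolding T_def C_def m_def n_def by (simp only:)
qed

end
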